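(* There is an algorithm which, given a chordal graph $G$ with $n$ vertices and anchor width $k$, computes the neighborhood polynomial $N_G(x)$ in at most $\mathcal{O}(n^3 k + n^2 k^2)$ time.
   Context: All graphs are finite, simple and undirected. A graph is chordal if it has no induced cycle of length at least $4$. For a graph $G=(V,E)$ and $v\in V$, $N_G(v)=\{u\in V\mid uv\in E\}$. The neighborhood complex is $\mathcal{N}_G=\{U\subseteq V\mid \exists v\in V: U\subseteq N_G(v)\}$, and the neighborhood polynomial is $N_G(x)=\sum_{U\in\mathcal{N}_G}x^{|U|}$. For $W\subseteq V$ let $N_G^{\cap}(W)=\bigcap_{w\in W}N_G(w)$ and $N_G^{\cup}(W)=\bigcup_{w\in W}N_G(w)$ (with $N_G^{\cap}(\emptyset)=V$). For a clique $C$ of $G$, the periphery of $C$ is $P_G(C)=N_G^{\cup}(C)\setminus C$; for $M\subseteq P_G(C)$ the corresponding anchor set is $A_G(M,C)=N_G^{\cap}(M)\cap C$ whenever this set is non-empty (so $A_G(\emptyset,C)=C$). The anchor family of $C$ is $\mathcal{A}_G(C)=\{A\subseteq C\mid A\neq\emptyset,\ \exists M\subseteq P_G(C): A=A_G(M,C)\}$. The anchor width of $G$ is the smallest number $k$ such that $|\mathcal{A}_G(C)|\le k$ for all cliques $C$ of $G$. *)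

theory Defs
  imports
    "Graph_Theory.Pair_Digraph"
    "HOL-Computational_Algebra.Polynomial"
begin

section \<open>Graphs\<close>

text \<open>
  Finite simple undirected graphs are represented by the locale \<^locale>\<open>pair_graph\<close>: finite, loop-free
  digraphs whose arc set is a symmetric relation. Thus \<open>uv\<close> is an edge iff \<open>(u, v) \<in> parcs G\<close>.
\<close>

text \<open>
  The list \<open>vs\<close> enumerates the vertices of an induced cycle in cyclic order: the edges among
  these vertices are exactly those between cyclically consecutive ones.
\<close>

definition induced_cycle :: "'a pair_pre_digraph \<Rightarrow> 'a list \<Rightarrow> bool" where
  "induced_cycle G vs \<longleftrightarrow>
     length vs \<ge> 3 \<and> distinct vs \<and> set vs \<subseteq> pverts G \<and>
     (\<forall>i < length vs. \<forall>j < length vs.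
        (vs ! i, vs ! j) \<in> parcs G \<longleftrightarrow>
          j = Suc i mod length vs \<or> i = Suc j mod length vs)"

definition chordal :: "'a pair_pre_digraph \<Rightarrow> bool" where
  "chordal G \<longleftrightarrow> \<not> (\<exists>vs. induced_cycle G vs \<and> length vs \<ge> 4)"

definition clique :: "'a pair_pre_digraph \<Rightarrow> 'a set \<Rightarrow> bool" where
  "clique G C \<longleftrightarrow> C \<subseteq> pverts G \<and> (\<forall>u \<in> C. \<forall>v \<in> C. u \<noteq> v \<longrightarrow> (u, v) \<in> parcs G)"

definition nbh :: "'a pair_pre_digraph \<Rightarrow> 'a \<Rightarrow> 'a set" where
  "nbh G v = {u \<in> pverts G. (u, v) \<in> parcs G}"

definition nbh_complex :: "'a pair_pre_digraph \<Rightarrow> 'a set set" where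
  "nbh_complex G = {U. U \<subseteq> pverts G \<and> (\<exists>v \<in> pverts G. U \<subseteq> nbh G v)}"

definition nbh_poly :: "'a pair_pre_digraph \<Rightarrow> int poly" where
  "nbh_poly G = (\<Sum>U \<in> nbh_complex G. monom 1 (card U))"

text \<open>Intersecting with the vertex set only matters for \<open>W = {}\<close>, where the value is the vertex set.\<close>

definition nbh_Inter :: "'a pair_pre_digraph \<Rightarrow> 'a set \<Rightarrow> 'a set" where
  "nbh_Inter G W = pverts G \<inter> (\<Inter>w \<in> W. nbh G w)"

definition nbh_Union :: "'a pair_pre_digraph \<Rightarrow> 'a set \<Rightarrow> 'a set" where
  "nbh_Union G W = (\<Union>w \<in> W. nbh G w)"

definition periphery :: "'a pair_pre_digraph \<Rightarrow> 'a set \<Rightarrow> 'a set" where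
  "periphery G C = nbh_Union G C - C"

definition anchor_set :: "'a pair_pre_digraph \<Rightarrow> 'a set \<Rightarrow> 'a set \<Rightarrow> 'a set" where
  "anchor_set G M C = nbh_Inter G M \<inter> C"

definition anchor_family :: "'a pair_pre_digraph \<Rightarrow> 'a set \<Rightarrow> 'a set set" where
  "anchor_family G C =
     {A. A \<subseteq> C \<and> A \<noteq> {} \<and> (\<exists>M. M \<subseteq> periphery G C \<and> A = anchor_set G M C)}"

definition anchor_width :: "'a pair_pre_digraph \<Rightarrow> nat" where
  "anchor_width G = (LEAST k. \<forall>C. clique G C \<longrightarrow> card (anchor_family G C) \<le> k)"


section \<open>Model of computation\<close>

text \<open>
  Algorithms are while-programs for a random access machine under the uniform cost criterion.
  The memory holds natural numbers, in scalar variables and in one-dimensional arrays of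
  unbounded length; a fixed program mentions only finitely many of either. The only arithmetic
  operations are addition and (truncated) subtraction; multiplication is not primitive, so that
  unit cost per operation does not give the machine super-polynomial power. Each occurrence of a
  constant, variable, array access, arithmetic, comparison or Boolean operation, each write
  and each branch costs one time unit every time it is evaluated.
\<close>

datatype aexp =
    Const nat
  | Var string
  | Read string aexp
  | Add aexp aexp
  | Sub aexp aexp

datatype bexp =
    Less aexp aexp
  | Equal aexp aexp
  | Not bexp
  | And bexp bexp

datatype com =
    Skip
  | Assign string aexp
  | Write string aexp aexp
  | Seq com com
  | If bexp com com
  | While bexp com

record state =
  vars :: "string \<Rightarrow> nat"
  arrays :: "string \<Rightarrow> nat \<Rightarrow> nat"

primrec aval :: "aexp \<Rightarrow> state \<Rightarrow> nat" where
  "aval (Const m) s = m"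
| "aval (Var x) s = vars s x"
| "aval (Read a e) s = arrays s a (aval e s)"
| "aval (Add e1 e2) s = aval e1 s + aval e2 s"
| "aval (Sub e1 e2) s = aval e1 s - aval e2 s"

primrec bval :: "bexp \<Rightarrow> state \<Rightarrow> bool" where
  "bval (Less e1 e2) s \<longleftrightarrow> aval e1 s < aval e2 s"
| "bval (Equal e1 e2) s \<longleftrightarrow> aval e1 s = aval e2 s"
| "bval (Not b) s \<longleftrightarrow> \<not> bval b s"
| "bval (And b1 b2) s \<longleftrightarrow> bval b1 s \<and> bval b2 s"

primrec acost :: "aexp \<Rightarrow> nat" where
  "acost (Const m) = 1"
| "acost (Var x) = 1"
| "acost (Read a e) = 1 + acost e"
| "acost (Add e1 e2) = 1 + acost e1 + acost e2"
| "acost (Sub e1 e2) = 1 + acost e1 + acost e2"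

primrec bcost :: "bexp \<Rightarrow> nat" where
  "bcost (Less e1 e2) = 1 + acost e1 + acost e2"
| "bcost (Equal e1 e2) = 1 + acost e1 + acost e2"
| "bcost (Not b) = 1 + bcost b"
| "bcost (And b1 b2) = 1 + bcost b1 + bcost b2"

text \<open>\<open>exec c s t s'\<close>: started in state \<open>s\<close>, program \<open>c\<close> halts in state \<open>s'\<close> after \<open>t\<close> time units.\<close>

inductive exec :: "com \<Rightarrow> state \<Rightarrow> nat \<Rightarrow> state \<Rightarrow> bool" where
  exec_Skip: "exec Skip s 1 s"
| exec_Assign:
    "exec (Assign x e) s (1 + acost e) (s\<lparr>vars := (vars s)(x := aval e s)\<rparr>)"
| exec_Write:
    "exec (Write a i e) s (1 + acost i + acost e)
       (s\<lparr>arrays := (arrays s)(a := (arrays s a)(aval i s := aval e s))\<rparr>)"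
| exec_Seq:
    "exec c1 s t1 s' \<Longrightarrow> exec c2 s' t2 s'' \<Longrightarrow> exec (Seq c1 c2) s (t1 + t2) s''"
| exec_If_True:
    "bval b s \<Longrightarrow> exec c1 s t s' \<Longrightarrow> exec (If b c1 c2) s (1 + bcost b + t) s'"
| exec_If_False:
    "\<not> bval b s \<Longrightarrow> exec c2 s t s' \<Longrightarrow> exec (If b c1 c2) s (1 + bcost b + t) s'"
| exec_While_False:
    "\<not> bval b s \<Longrightarrow> exec (While b c) s (1 + bcost b) s"
| exec_While_True:
    "bval b s \<Longrightarrow> exec c s t1 s' \<Longrightarrow> exec (While b c) s' t2 s'' \<Longrightarrow>
     exec (While b c) s (1 + bcost b + t1 + t2) s''"

lemma exec_deterministic:
  assumes "exec c s t s'" and "exec c s u r"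
  shows "t = u \<and> s' = r"
  using assms
proof (induction arbitrary: u r rule: exec.induct)
  case (exec_Skip s)
  then show ?case by cases simp
next
  case (exec_Assign x e s)
  then show ?case by cases simp
next
  case (exec_Write a i e s)
  then show ?case by cases simp
next
  case (exec_Seq c1 s t1 s' c2 t2 s'')
  from exec_Seq.prems show ?case by cases (use exec_Seq.IH in blast)
next
  case (exec_If_True b s c1 t s' c2)
  from exec_If_True.prems show ?case by cases (use exec_If_True in blast)+
next
  case (exec_If_False b s c2 t s' c1)
  from exec_If_False.prems show ?case by cases (use exec_If_False in blast)+
next
  case (exec_While_False b s c)
  from exec_While_False.prems show ?case by cases (use exec_While_False in blast)+
next
  case (exec_While_True b s c t1 s' t2 s'')
  from exec_While_True.prems show ?case by cases (use exec_While_True.hyps(1) exec_While_True.IH in blast)+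
qed

text \<open>
  The input graph has vertices \<open>0, \<dots>, n - 1\<close> and is given by \<open>n\<close> and its adjacency matrix,
  stored row by row; all other memory cells are zero. The anchor width is not part of the input.
\<close>

definition input_state :: "nat \<Rightarrow> nat pair_pre_digraph \<Rightarrow> state" where
  "input_state n G =
     \<lparr> vars = (\<lambda>_. 0)(''n'' := n),
       arrays = (\<lambda>_ _. 0)(''adj'' :=
         (\<lambda>m. if m < n * n \<and> (m div n, m mod n) \<in> parcs G then 1 else 0)) \<rparr>"

text \<open>The output is the polynomial whose coefficients of degree \<open>0, \<dots>, n\<close> are in array \<open>out\<close>.\<close>

definition output_poly :: "nat \<Rightarrow> state \<Rightarrow> int poly" where
  "output_poly n s = Poly (map (\<lambda>i. int (arrays s ''out'' i)) [0..<Suc n])"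

end

theory Submission
  imports Defs "HOL-Library.Nat_Bijection"
begin

text \<open>
  A chordal graph is dismantled by removing simplicial vertices. Let \<open>v\<close> be simplicial, \<open>R\<close> the set of
  other remaining vertices and \<open>C\<close> the clique of neighbours of \<open>v\<close> in \<open>R\<close>. With \<open>v\<close>, the
  neighbourhood complex gains the sets \<open>U \<union> {v}\<close> with \<open>U \<subseteq> R\<close> having a common neighbour in \<open>C\<close>, and at most
  one further set, \<open>C\<close> itself, because a proper subset of \<open>C\<close> already has a common neighbour in \<open>C\<close>.
  Splitting \<open>U\<close> into \<open>M = U - C\<close> and \<open>U \<inter> C\<close>, there is no common neighbour in \<open>C\<close> iff the
  anchor set of \<open>M\<close> is contained in \<open>U\<close>. These bad sets are counted by size and by the anchor set of
  \<open>M\<close>, adding the vertices of \<open>R\<close> one at a time, first those outside \<open>C\<close>. At most \<open>k + 1\<close> anchor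
  sets occur and every update of a row of coefficients takes time \<open>O(n)\<close>, so a removal costs
  \<open>O(n\<^sup>2 k)\<close> and the whole algorithm \<open>O(n\<^sup>3 k)\<close>.

  Simplicial vertices are found by maintaining \<open>|N[x] - N[a]|\<close> within the remaining vertices for all \<open>x\<close>
  and \<open>a\<close>. A vertex set \<open>X\<close> is stored as the number \<open>(n + 2) \<cdot> (\<Sum>u\<in>X. 2\<^sup>u)\<close>, which serves directly as an array
  address with room for \<open>n + 2\<close> cells.
\<close>

section \<open>Simplicial vertices of chordal graphs\<close>

text \<open>Why \<open>k\<close> bounds the anchor sets at every stage: the remaining neighbours
  \<open>C\<close> of a simplicial vertex form a clique of the whole graph, and if \<open>M\<close>
  has a nonempty anchor set, some vertex of \<open>C\<close> is adjacent to all of \<open>M\<close>,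
  so \<open>M\<close> lies in the periphery. Only the empty anchor set can fall outside the anchor
  family, hence \<open>k + 1\<close>. A partially built \<open>M\<close> is itself such an
  \<open>M\<close>, so intermediate tables obey the same bound. Vertices outside \<open>C\<close>
  come first because the anchor set depends on \<open>U - C\<close> alone. Once it is settled, a
  vertex of \<open>C\<close> may be omitted from a bad set exactly if it lies outside the anchor
  set. Each nonempty vertex set is examined when the first of its members is removed. A set found
  bad then may have lost its last common neighbour \<open>w\<close> earlier; at the removal of
  \<open>w\<close> it was the whole neighbourhood of \<open>w\<close>, and the one further set
  counted there compensates. The program does not know \<open>k\<close> and cannot multiply: anchor
  sets are listed as they are discovered, and products come from tables built by addition.\<close>

lemma rtrancl_imp_path:
  assumes "(a, b) \<in> r\<^sup>*"
  shows "\<exists>p. p \<noteq> [] \<and> hd p = a \<and> last p = b \<and> successively (\<lambda>x y. (x, y) \<in> r) p"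
  using assms
proof (induction rule: rtrancl_induct)
  case base
  show ?case by (rule exI[of _ "[a]"]) simp
next
  case (step y z)
  then obtain p where "p \<noteq> []" "hd p = a" "last p = y" "successively (\<lambda>x y. (x, y) \<in> r) p"
    by blast
  with step(2) show ?case
    by (intro exI[of _ "p @ [z]"]) (auto simp: successively_append_iff)
qed

context pair_graph
begin

lemma parcs_sym: "(u, v) \<in> parcs G \<longleftrightarrow> (v, u) \<in> parcs G"
  using pair_sym_arcs by (auto simp: symmetric_def dest: symD)

lemma parcs_irrefl: "(u, u) \<notin> parcs G"
  using pair_no_loops by force

text \<open>A shortest path from \<open>s\<close> to \<open>t\<close> through \<open>Z\<close> is chordless, so it closes to an induced cycle via \<open>x\<close>.\<close>

lemma not_chordal_if_path_avoiding_nbh: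
  assumes xs: "(x, s) \<in> parcs G" and xt: "(x, t) \<in> parcs G"
    and st: "s \<noteq> t" "(s, t) \<notin> parcs G"
    and Z: "Z \<subseteq> pverts G" "x \<notin> Z" "\<And>y. y \<in> Z \<Longrightarrow> (x, y) \<notin> parcs G"
    and p: "set p \<subseteq> Z" "successively (\<lambda>a b. (a, b) \<in> parcs G) (s # p @ [t])"
  shows "\<not> chordal G"
proof -
  let ?E = "\<lambda>a b. (a, b) \<in> parcs G"
  define P where "P q \<longleftrightarrow> q \<noteq> [] \<and> hd q = s \<and> last q = t \<and> set q \<subseteq> Z \<union> {s, t} \<and> successively ?E q" for q
  have "P (s # p @ [t])" using p by (auto simp: P_def)
  define q where "q = arg_min length P"
  have q: "P q" and qmin: "\<And>q'. P q' \<Longrightarrow> length q \<le> length q'"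
    unfolding q_def using arg_min_nat_lemma[of P, OF \<open>P (s # p @ [t])\<close>] by auto
  let ?l = "length q"
  have qne: "q \<noteq> []" and q0: "q ! 0 = s" and ql: "q ! (?l - 1) = t"
    and qs: "set q \<subseteq> Z \<union> {s, t}" and qE: "successively ?E q"
    using q by (auto simp: P_def hd_conv_nth last_conv_nth)
  have qn: "(q ! i, q ! Suc i) \<in> parcs G" if "Suc i < ?l" for i
    using qE that by (simp add: successively_conv_nth)
  \<comment> \<open>Chords and repeated vertices are both excluded by minimality of
    \<open>q\<close>: each allows a segment to be cut out.\<close>
  have shortcut: False
    if ij: "i < j" "j \<le> ?l" "P (take (Suc i) q @ drop j q)" "Suc i < j" for i j
    using qmin[OF ij(3)] ij by auto
  have hdt: "hd (take (Suc i) q) = s" for i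
    using q by (auto simp: P_def hd_conv_nth)
  have lastt: "last (take (Suc i) q) = q ! i" if "i < ?l" for i
    using that by (simp add: take_Suc_conv_app_nth)
  have succ_take: "successively ?E (take m q)" and succ_drop: "successively ?E (drop m q)" for m
    using qE by (metis append_take_drop_id successively_append_iff)+
  have sub: "set (take m q) \<subseteq> Z \<union> {s, t}" "set (drop m q) \<subseteq> Z \<union> {s, t}" for m
    using qs set_take_subset[of m q] set_drop_subset[of m q] by blast+
  have chord: "j = Suc i" if ij: "i < j" "j < ?l" "(q ! i, q ! j) \<in> parcs G" for i j
  proof (rule ccontr)
    assume "j \<noteq> Suc i"
    with ij have lt: "Suc i < j" by simp
    have "P (take (Suc i) q @ drop j q)"
      unfolding P_def using ij q sub hdt succ_take succ_drop lastt[of i] qne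
      by (auto simp: successively_append_iff hd_drop_conv_nth P_def hd_append simp del: take_Suc)
    then show False using shortcut ij lt by force
  qed
  have dist: "q ! i \<noteq> q ! j" if ij: "i < j" "j < ?l" for i j
  proof
    assume eq: "q ! i = q ! j"
    have "P (take (Suc i) q @ drop (Suc j) q)"
    proof (cases "Suc j = ?l")
      case True
      \<comment> \<open>Nothing remains behind the cut; the shortened path ends in
        \<open>q ! i\<close>, which is \<open>t\<close>.\<close>
      have "q ! j = t" using ql True by (metis diff_Suc_1)
      then show ?thesis
        unfolding P_def using True ij eq sub hdt succ_take lastt[of i] qne by auto
    next
      case False
      then have "Suc j < ?l" using ij by simp
      then show ?thesis
        unfolding P_def using ij q sub hdt succ_take succ_drop lastt[of i] qne qn[of j] eq
        by (auto simp: successively_append_iff hd_drop_conv_nth P_def hd_append)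
    qed
    then show False using shortcut[of i "Suc j"] ij by force
  qed
  have distq: "distinct q"
    unfolding distinct_conv_nth by (metis dist nat_neq_iff)
  \<comment> \<open>One or two vertices would force \<open>s = t\<close> or an edge between them.
    Together with \<open>x\<close>, three vertices give a cycle of length at least 4.\<close>
  have l3: "?l \<ge> 3"
  proof (rule ccontr)
    assume "\<not> ?l \<ge> 3"
    moreover have "?l \<noteq> 0" using qne by simp
    ultimately consider "?l = 1" | "?l = 2" by linarith
    then show False
      using q0 ql st qn[of 0] by cases auto
  qed
  have inZ: "q ! i \<in> Z" if "0 < i" "i < ?l - 1" for i
  proof -
    have "q ! i \<in> Z \<union> {s, t}" using qs that by (metis One_nat_def add_lessD1 less_diff_conv nth_mem subsetD)
    moreover have "q ! i \<noteq> s" using dist[of 0 i] q0 that by fastforce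
    moreover have "q ! i \<noteq> t" using dist[of i "?l - 1"] ql that by auto
    ultimately show ?thesis by blast
  qed
  have xadj: "(x, q ! j) \<in> parcs G \<longleftrightarrow> j = 0 \<or> Suc j = ?l" if "j < ?l" for j
  proof (cases "j = 0 \<or> Suc j = ?l")
    case True
    then show ?thesis
    proof
      assume "Suc j = ?l"
      then have "q ! j = t" using ql by (metis diff_Suc_1)
      then show ?thesis using xt \<open>Suc j = ?l\<close> by simp
    qed (use xs q0 in simp)
  next
    case False
    then have "q ! j \<in> Z" using that by (intro inZ) auto
    then show ?thesis using Z(3) False by blast
  qed
  have qadj: "(q ! i, q ! j) \<in> parcs G \<longleftrightarrow> j = Suc i \<or> i = Suc j" if "i < ?l" "j < ?l" for i j
  proof (cases i j rule: linorder_cases)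
    case less
    then show ?thesis using that chord[of i j] qn[of i] by auto
  next
    case equal
    then show ?thesis using parcs_irrefl by auto
  next
    case greater
    then show ?thesis using that chord[of j i] qn[of j] parcs_sym[of "q ! i"] by auto
  qed
  have "induced_cycle G (x # q)"
    unfolding induced_cycle_def
  proof (intro conjI allI impI)
    show "3 \<le> length (x # q)" using l3 by simp
    have "x \<noteq> s" "x \<noteq> t" using xs xt parcs_irrefl by auto
    then show "distinct (x # q)" using distq qs Z(2) by auto
    show "set (x # q) \<subseteq> pverts G"
      using qs Z(1) xs xt in_arcsD1 in_arcsD2 by auto
  next
    fix i j
    assume i: "i < length (x # q)" and j: "j < length (x # q)"
    have m: "Suc a mod length (x # q) = (if a = ?l then 0 else Suc a)" if "a < length (x # q)" for a
      using that by simp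
    have "((x # q) ! i, (x # q) ! j) \<in> parcs G \<longleftrightarrow>
        j = (if i = ?l then 0 else Suc i) \<or> i = (if j = ?l then 0 else Suc j)"
    proof (cases i)
      case i0: 0
      show ?thesis
      proof (cases j)
        case 0
        then show ?thesis using i0 qne parcs_irrefl by simp
      next
        case (Suc j')
        then show ?thesis using i0 l3 xadj[of j'] j by auto
      qed
    next
      case i': (Suc i')
      show ?thesis
      proof (cases j)
        case 0
        have "(q ! i', x) \<in> parcs G \<longleftrightarrow> i' = 0 \<or> Suc i' = ?l"
          using xadj[of i'] parcs_sym[of "q ! i'" x] i i' by simp
        moreover have "((x # q) ! i, (x # q) ! j) = (q ! i', x)" using i' 0 by simp
        moreover have "?l > 0" using qne by simp
        ultimately show ?thesis unfolding i' 0 by (cases "Suc i' = ?l") simp_all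
      next
        case (Suc j')
        then have "((x # q) ! i, (x # q) ! j) = (q ! i', q ! j')" using i' by simp
        moreover have "i' < ?l" "j' < ?l" using i j i' Suc by simp_all
        ultimately have "((x # q) ! i, (x # q) ! j) \<in> parcs G \<longleftrightarrow> j' = Suc i' \<or> i' = Suc j'"
          using qadj by metis
        moreover have "j' = Suc i' \<or> i' = Suc j' \<longleftrightarrow>
            Suc j' = (if Suc i' = l then 0 else Suc (Suc i')) \<or>
            Suc i' = (if Suc j' = l then 0 else Suc (Suc j'))" if "i' < l" "j' < l" for l
          using that by auto
        ultimately show ?thesis unfolding i' Suc using \<open>i' < ?l\<close> \<open>j' < ?l\<close> by metis
      qed
    qed
    then show "((x # q) ! i, (x # q) ! j) \<in> parcs G \<longleftrightarrow>
        j = Suc i mod length (x # q) \<or> i = Suc j mod length (x # q)"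
      unfolding m[OF i] m[OF j] .
  qed
  then show ?thesis using l3 unfolding chordal_def by (auto intro!: exI[of _ "x # q"])
qed

text \<open>
  Dirac's argument: for a component \<open>K\<close> of the non-neighbours of \<open>x\<close>, the attachment set \<open>S\<close> of
  \<open>K\<close> is a clique by chordality, and \<open>K \<union> S\<close> is a smaller graph to which induction applies.
\<close>

lemma chordal_simplicial_non_nbh:
  assumes ch: "chordal G" and W: "W \<subseteq> pverts G" and x: "x \<in> W" and z: "z \<in> W" "z \<noteq> x" "(x, z) \<notin> parcs G"
  shows "\<exists>y\<in>W. y \<noteq> x \<and> (x, y) \<notin> parcs G \<and>
    (\<forall>a\<in>W. \<forall>b\<in>W. (y, a) \<in> parcs G \<longrightarrow> (y, b) \<in> parcs G \<longrightarrow> a \<noteq> b \<longrightarrow> (a, b) \<in> parcs G)"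
proof -
  have "finite W" using W pair_finite_verts finite_subset by blast
  then show ?thesis using W x z
  proof (induction W arbitrary: x z rule: finite_psubset_induct)
    case (psubset W)
    define Z where "Z = {y \<in> W. y \<noteq> x \<and> (x, y) \<notin> parcs G}"
    define r where "r = {(a, b). a \<in> Z \<and> b \<in> Z \<and> (a, b) \<in> parcs G}"
    define K where "K = {y. (z, y) \<in> r\<^sup>*}"
    define S where "S = {s \<in> W - K. \<exists>k\<in>K. (k, s) \<in> parcs G}"
    have zZ: "z \<in> Z" using psubset.prems by (simp add: Z_def)
    have zK: "z \<in> K" by (simp add: K_def)
    have KZ: "K \<subseteq> Z"
    proof
      fix y assume "y \<in> K"
      then have "(z, y) \<in> r\<^sup>*" by (simp add: K_def)
      then show "y \<in> Z" by (cases rule: rtranclE) (use zZ r_def in auto)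
    qed
    have symr: "sym (r\<^sup>*)"
      by (rule sym_rtrancl) (auto simp: sym_def r_def parcs_sym)
    have Sx: "(x, s) \<in> parcs G" if "s \<in> S" for s
    proof (rule ccontr)
      assume n: "(x, s) \<notin> parcs G"
      from that obtain k where k: "k \<in> K" "(k, s) \<in> parcs G" and s: "s \<in> W" "s \<notin> K"
        by (auto simp: S_def)
      have "s \<noteq> x" using k KZ parcs_sym[of x k] by (auto simp: Z_def)
      then have "s \<in> Z" using n s by (simp add: Z_def)
      then have "(k, s) \<in> r" using k KZ by (auto simp: r_def)
      then have "s \<in> K" using k(1) unfolding K_def by (simp add: rtrancl.rtrancl_into_rtrancl)
      then show False using s by simp
    qed
    have Sclique: "(s, t) \<in> parcs G" if "s \<in> S" "t \<in> S" "s \<noteq> t" for s t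
    proof (rule ccontr)
      assume n: "(s, t) \<notin> parcs G"
      from that obtain k l where k: "k \<in> K" "(k, s) \<in> parcs G" and l: "l \<in> K" "(l, t) \<in> parcs G"
        by (auto simp: S_def)
      have "(k, z) \<in> r\<^sup>*" "(z, l) \<in> r\<^sup>*"
        using k l symr by (auto simp: K_def dest: symD)
      then have "(k, l) \<in> r\<^sup>*" by (rule rtrancl_trans)
      then obtain p where p: "p \<noteq> []" "hd p = k" "last p = l" "successively (\<lambda>x y. (x, y) \<in> r) p"
        using rtrancl_imp_path by metis
      \<comment> \<open>Every step of \<open>r\<close> has both ends in \<open>Z\<close>; a
        one-element path has no step and is treated through its end \<open>k\<close>.\<close>
      have pK: "set p \<subseteq> Z"
      proof (cases "length p = 1")
        case True
        then obtain a where "p = [a]" by (auto simp: length_Suc_conv)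
        then show ?thesis using p k KZ by auto
      next
        case False
        have "p ! i \<in> Z" if i: "i < length p" for i
        proof (cases "Suc i < length p")
          case True
          then have "(p ! i, p ! Suc i) \<in> r" using p(4) by (simp add: successively_conv_nth)
          then show ?thesis by (simp add: r_def)
        next
          case F: False
          then obtain i' where "i = Suc i'" using False i by (cases i) auto
          then have "(p ! i', p ! i) \<in> r" using p(4) i by (simp add: successively_conv_nth)
          then show ?thesis by (simp add: r_def)
        qed
        then show ?thesis by (auto simp: in_set_conv_nth)
      qed
      have pE: "successively (\<lambda>a b. (a, b) \<in> parcs G) p"
        using p(4) by (rule successively_mono) (auto simp: r_def)
      have "successively (\<lambda>a b. (a, b) \<in> parcs G) (s # p @ [t])"
        using pE p k l parcs_sym[of k s] by (auto simp: successively_append_iff successively_Cons)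
      moreover have "Z \<subseteq> pverts G" using psubset.prems(1) by (auto simp: Z_def)
      ultimately have "\<not> chordal G"
        by (intro not_chordal_if_path_avoiding_nbh[OF Sx[OF that(1)] Sx[OF that(2)] that(3) n _ _ _ pK])
          (auto simp: Z_def)
      then show False using ch by simp
    qed
    let ?W = "K \<union> S"
    have sub: "?W \<subset> W"
    proof -
      have "x \<notin> ?W" using KZ Sx parcs_irrefl by (auto simp: Z_def)
      moreover have "?W \<subseteq> W" using KZ by (auto simp: Z_def S_def)
      ultimately show ?thesis using psubset.prems by blast
    qed
    have WV: "?W \<subseteq> pverts G" using sub psubset.prems(1) by auto
    \<comment> \<open>All neighbours in \<open>W\<close> of a vertex of \<open>K\<close> lie in
      \<open>K\<close> or \<open>S\<close>, so being simplicial there carries over to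
      \<open>W\<close>.\<close>
    have finish: ?case
      if y: "y \<in> K" "\<forall>a\<in>?W. \<forall>b\<in>?W. (y, a) \<in> parcs G \<longrightarrow> (y, b) \<in> parcs G \<longrightarrow> a \<noteq> b \<longrightarrow> (a, b) \<in> parcs G" for y
    proof -
      have "a \<in> ?W" if "a \<in> W" "(y, a) \<in> parcs G" for a
        using that y(1) by (auto simp: S_def)
      then show ?thesis using y KZ by (intro bexI[of _ y]) (auto simp: Z_def)
    qed
    show ?case
    proof (cases "\<exists>s\<in>S. \<exists>u\<in>?W. u \<noteq> s \<and> (s, u) \<notin> parcs G")
      case True
      then obtain s u where "s \<in> S" "u \<in> ?W" "u \<noteq> s" "(s, u) \<notin> parcs G" by blast
      with psubset.IH[OF sub WV, of s u] obtain y where y: "y \<in> ?W" "y \<noteq> s" "(s, y) \<notin> parcs G"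
        "\<forall>a\<in>?W. \<forall>b\<in>?W. (y, a) \<in> parcs G \<longrightarrow> (y, b) \<in> parcs G \<longrightarrow> a \<noteq> b \<longrightarrow> (a, b) \<in> parcs G"
        by blast
      \<comment> \<open>\<open>y\<close> is not adjacent to \<open>s\<close>, whereas
        \<open>S\<close> is a clique.\<close>
      then have "y \<in> K" using Sclique \<open>s \<in> S\<close> by blast
      then show ?thesis using finish y by blast
    next
      case univ: False
      show ?thesis
      proof (cases "\<exists>s\<in>?W. \<exists>u\<in>?W. u \<noteq> s \<and> (s, u) \<notin> parcs G")
        case True
        then obtain s u where s: "s \<in> ?W" "u \<in> ?W" "u \<noteq> s" "(s, u) \<notin> parcs G" by blast
        with psubset.IH[OF sub WV, of s u] obtain y where y: "y \<in> ?W" "y \<noteq> s" "(s, y) \<notin> parcs G"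
          "\<forall>a\<in>?W. \<forall>b\<in>?W. (y, a) \<in> parcs G \<longrightarrow> (y, b) \<in> parcs G \<longrightarrow> a \<noteq> b \<longrightarrow> (a, b) \<in> parcs G"
          by blast
        \<comment> \<open>In this case a vertex of \<open>S\<close> is adjacent to all others, so it
          could not miss \<open>s\<close>.\<close>
        then have "y \<in> K" using univ s(1) parcs_sym[of s y] by (metis UnE)
        then show ?thesis using finish y by blast
      next
        case False
        \<comment> \<open>\<open>K\<close> and \<open>S\<close> together form a clique, in which
          \<open>z\<close> itself is simplicial.\<close>
        then show ?thesis using finish[of z] zK by metis
      qed
    qed
  qed
qed

lemma chordal_simplicial:
  assumes "chordal G" "W \<subseteq> pverts G" "W \<noteq> {}"
  shows "\<exists>y\<in>W. \<forall>a\<in>W. \<forall>b\<in>W. (y, a) \<in> parcs G \<longrightarrow> (y, b) \<in> parcs G \<longrightarrow> a \<noteq> b \<longrightarrow> (a, b) \<in> parcs G"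
proof (cases "\<exists>x\<in>W. \<exists>z\<in>W. z \<noteq> x \<and> (x, z) \<notin> parcs G")
  case True
  then show ?thesis using chordal_simplicial_non_nbh[OF assms(1,2)] by blast
next
  case False
  then have "(a, b) \<in> parcs G" if "a \<in> W" "b \<in> W" "a \<noteq> b" for a b using that by metis
  then show ?thesis using assms(3) by (meson all_not_in_conv)
qed

end

section \<open>Counting sets with a common neighbour\<close>

text \<open>The coefficient of degree \<open>j\<close> in the polynomial counting \<open>S\<close>
  by cardinality. The next three lemmas are addition, multiplication by the variable, and finite
  sums of such polynomials.\<close>

definition size_count :: "'a set set \<Rightarrow> nat \<Rightarrow> nat" where
  "size_count S j = card {U \<in> S. card U = j}"

lemma size_count_Un:
  assumes "finite S" "finite T" "S \<inter> T = {}"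
  shows "size_count (S \<union> T) j = size_count S j + size_count T j"
proof -
  have "{U \<in> S \<union> T. card U = j} = {U \<in> S. card U = j} \<union> {U \<in> T. card U = j}" by auto
  moreover have "{U \<in> S. card U = j} \<inter> {U \<in> T. card U = j} = {}" using assms(3) by auto
  ultimately show ?thesis unfolding size_count_def using assms by (simp add: card_Un_disjoint)
qed

lemma size_count_insert_image:
  assumes "finite W" "S \<subseteq> Pow W" "w \<notin> W"
  shows "size_count (insert w ` S) j = (if j = 0 then 0 else size_count S (j - 1))"
proof -
  have fin: "finite U" "w \<notin> U" if "U \<in> S" for U
    using that assms finite_subset by blast+
  have "{U \<in> insert w ` S. card U = j} = (if j = 0 then {} else insert w ` {U \<in> S. card U = j - 1})"
    using fin by (auto simp: image_iff)
  moreover have "inj_on (insert w) {U \<in> S. card U = j - 1}"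
    using fin by (intro inj_onI) (metis (mono_tags, lifting) Diff_insert_absorb mem_Collect_eq)
  ultimately show ?thesis unfolding size_count_def by (simp add: card_image)
qed

lemma size_count_UNION:
  assumes "finite T" "\<And>A. A \<in> T \<Longrightarrow> finite (F A)" "\<And>A B. A \<in> T \<Longrightarrow> B \<in> T \<Longrightarrow> A \<noteq> B \<Longrightarrow> F A \<inter> F B = {}"
  shows "size_count (\<Union>A\<in>T. F A) j = (\<Sum>A\<in>T. size_count (F A) j)"
proof -
  have "{U \<in> (\<Union>A\<in>T. F A). card U = j} = (\<Union>A\<in>T. {U \<in> F A. card U = j})" by auto
  moreover have "card (\<Union>A\<in>T. {U \<in> F A. card U = j}) = (\<Sum>A\<in>T. card {U \<in> F A. card U = j})"
  proof (rule card_UN_disjoint)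
    show "\<forall>i\<in>T. \<forall>j'\<in>T. i \<noteq> j' \<longrightarrow> {U \<in> F i. card U = j} \<inter> {U \<in> F j'. card U = j} = {}"
      using assms(3) by blast
  qed (use assms in auto)
  ultimately show ?thesis unfolding size_count_def by simp
qed

text \<open>With a reflexive \<open>cl\<close>, intersecting an anchor set with the closed
  neighbourhood of \<open>w\<close> changes nothing if \<open>w\<close> lies in the clique
  \<open>C\<close>. The program can therefore apply one and the same update to all vertices, inside
  and outside \<open>C\<close>.\<close>

definition anchor :: "('a \<Rightarrow> 'a \<Rightarrow> bool) \<Rightarrow> 'a set \<Rightarrow> 'a set \<Rightarrow> 'a set" where
  "anchor cl C M = {c \<in> C. \<forall>m\<in>M. cl m c}"

text \<open>
  \<open>blocked cl C W X\<close> also makes sense while only the vertices in \<open>W\<close> have been decided: the anchor set \<open>X\<close>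
  must not contain a vertex of \<open>W\<close> that was left out of \<open>U\<close>. Throughout, \<open>cl\<close> is the reflexive closure
  of adjacency.
\<close>

definition blocked :: "('a \<Rightarrow> 'a \<Rightarrow> bool) \<Rightarrow> 'a set \<Rightarrow> 'a set \<Rightarrow> 'a set \<Rightarrow> 'a set set" where
  "blocked cl C W X = {U. U \<subseteq> W \<and> anchor cl C (U - C) = X \<and> X \<inter> W \<subseteq> U}"

text \<open>For the reflexive closure \<open>cl\<close>, the condition \<open>cl u w\<close> with
  \<open>u\<close> distinct from \<open>w\<close> is adjacency, so this is the neighbourhood complex
  of the subgraph induced by \<open>R\<close>.\<close>

definition common_nbr_sets :: "('a \<Rightarrow> 'a \<Rightarrow> bool) \<Rightarrow> 'a set \<Rightarrow> 'a set set" where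
  "common_nbr_sets cl R = {U. U \<subseteq> R \<and> (\<exists>w\<in>R. \<forall>u\<in>U. cl u w \<and> u \<noteq> w)}"

lemma anchor_subset: "anchor cl C M \<subseteq> C"
  by (auto simp: anchor_def)

lemma finite_blocked: "finite W \<Longrightarrow> finite (blocked cl C W X)"
  by (rule finite_subset[of _ "Pow W"]) (auto simp: blocked_def)

lemma blocked_disjoint: "X \<noteq> Y \<Longrightarrow> blocked cl C W X \<inter> blocked cl C W Y = {}"
  by (auto simp: blocked_def)

text \<open>Leaving \<open>w\<close> out is admissible only if the anchor set avoids
  \<open>w\<close>; taking \<open>w\<close> in replaces an anchor set \<open>A\<close> by its part
  in the closed neighbourhood of \<open>w\<close>. \<open>WC\<close> encodes the order of
  processing: while anchor sets can still shrink, no vertex of \<open>C\<close> has been decided, so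
  the condition on \<open>X \<inter> W\<close> is vacuous.\<close>

lemma blocked_insert:
  assumes w: "w \<notin> W" and C: "\<And>a b. a \<in> C \<Longrightarrow> b \<in> C \<Longrightarrow> cl a b" and WC: "w \<notin> C \<Longrightarrow> W \<inter> C = {}"
  shows "blocked cl C (insert w W) X =
    {U \<in> blocked cl C W X. w \<notin> X} \<union> insert w ` (\<Union>A\<in>{A. A \<inter> Collect (cl w) = X}. blocked cl C W A)"
    (is "?L = ?R1 \<union> insert w ` ?R2")
proof (intro equalityI subsetI)
  have key: "insert w U \<in> ?L \<longleftrightarrow> U \<in> ?R2" if U: "U \<subseteq> W" for U
  proof (cases "w \<in> C")
    case True
    have "insert w U - C = U - C" using True by auto
    moreover have "anchor cl C (U - C) \<inter> Collect (cl w) = anchor cl C (U - C)"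
      using True C by (auto simp: anchor_def)
    ultimately show ?thesis using U w by (auto simp: blocked_def)
  next
    case False
    have "insert w U - C = insert w (U - C)" using False by auto
    moreover have "anchor cl C (insert w (U - C)) = anchor cl C (U - C) \<inter> Collect (cl w)"
      by (auto simp: anchor_def)
    moreover have "anchor cl C M \<inter> W = {}" for M using WC[OF False] by (auto simp: anchor_def)
    moreover have "anchor cl C M \<inter> insert w W = {}" for M using WC[OF False] False by (auto simp: anchor_def)
    ultimately show ?thesis using U w by (auto simp: blocked_def)
  qed
  {
    fix U assume U: "U \<in> ?L"
    show "U \<in> ?R1 \<union> insert w ` ?R2"
    proof (cases "w \<in> U")
      case True
      then have "insert w (U - {w}) = U" by auto
      moreover have "U - {w} \<subseteq> W" using U by (auto simp: blocked_def)
      ultimately have "U - {w} \<in> ?R2" using key U by metis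
      then show ?thesis using \<open>insert w (U - {w}) = U\<close> by blast
    next
      case False
      then show ?thesis using U by (auto simp: blocked_def)
    qed
  next
    fix U assume "U \<in> ?R1 \<union> insert w ` ?R2"
    then show "U \<in> ?L"
    proof
      assume "U \<in> ?R1"
      then show ?thesis by (auto simp: blocked_def)
    next
      assume "U \<in> insert w ` ?R2"
      then obtain U' where U': "U' \<in> ?R2" "U = insert w U'" by blast
      moreover from U' have "U' \<subseteq> W" by (auto simp: blocked_def)
      ultimately show ?thesis using key by blast
    qed
  }
qed

text \<open>The recurrence in the form in which the program executes it: each listed
  \<open>A\<close> is visited once and sends its row to at most two targets, unshifted to
  \<open>A\<close> itself and shifted by one degree to the intersection with the closed
  neighbourhood of \<open>w\<close>.\<close>

lemma size_count_blocked_insert: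
  assumes W: "finite W" and T: "finite T" "\<And>U. U \<subseteq> W \<Longrightarrow> anchor cl C (U - C) \<in> T"
    and w: "w \<notin> W" and C: "\<And>a b. a \<in> C \<Longrightarrow> b \<in> C \<Longrightarrow> cl a b" and WC: "w \<notin> C \<Longrightarrow> W \<inter> C = {}"
  shows "size_count (blocked cl C (insert w W) X) j =
    (\<Sum>A\<in>T. (if A = X \<and> w \<notin> A then size_count (blocked cl C W A) j else 0) +
           (if A \<inter> Collect (cl w) = X \<and> j \<noteq> 0 then size_count (blocked cl C W A) (j - 1) else 0))"
proof -
  let ?b = "blocked cl C W"
  let ?T = "{A \<in> T. A \<inter> Collect (cl w) = X}"
  \<comment> \<open>Sets that are not listed have an empty family, so the union over all
    \<open>A\<close> reduces to the listed ones.\<close>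
  have empty: "?b A = {}" if "A \<notin> T" for A
    using that T(2) by (auto simp: blocked_def)
  have sub: "?b A \<subseteq> Pow W" for A by (auto simp: blocked_def)
  have eq: "blocked cl C (insert w W) X = {U \<in> ?b X. w \<notin> X} \<union> insert w ` (\<Union>A\<in>?T. ?b A)"
  proof -
    have "(\<Union>A\<in>{A. A \<inter> Collect (cl w) = X}. ?b A) = (\<Union>A\<in>?T. ?b A)"
      using empty by fastforce
    then show ?thesis using blocked_insert[of w W C cl X, OF w C WC] by simp
  qed
  have "size_count (blocked cl C (insert w W) X) j =
      size_count {U \<in> ?b X. w \<notin> X} j + size_count (insert w ` (\<Union>A\<in>?T. ?b A)) j"
    unfolding eq
  proof (rule size_count_Un)
    show "{U \<in> ?b X. w \<notin> X} \<inter> insert w ` (\<Union>A\<in>?T. ?b A) = {}"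
      using w by (auto simp: blocked_def)
  qed (use T finite_blocked[OF W] in auto)
  also have "size_count (insert w ` (\<Union>A\<in>?T. ?b A)) j =
      (if j = 0 then 0 else size_count (\<Union>A\<in>?T. ?b A) (j - 1))"
    using sub by (intro size_count_insert_image[OF W _ w]) blast
  also have "size_count (\<Union>A\<in>?T. ?b A) (j - 1) = (\<Sum>A\<in>?T. size_count (?b A) (j - 1))"
    using T finite_blocked[OF W] by (intro size_count_UNION blocked_disjoint) simp_all
  also have "size_count {U \<in> ?b X. w \<notin> X} j = (\<Sum>A\<in>T. if A = X \<and> w \<notin> A then size_count (?b A) j else 0)"
  proof (cases "w \<in> X")
    case True
    then have "(if A = X \<and> w \<notin> A then size_count (?b A) j else 0) = 0" for A by auto
    then show ?thesis using True by (simp add: size_count_def)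
  next
    case False
    then have "(if A = X \<and> w \<notin> A then size_count (?b A) j else 0) = (if A = X then size_count (?b A) j else 0)" for A by auto
    then show ?thesis using False T(1) empty[of X] by (simp add: size_count_def)
  qed
  finally show ?thesis
    by (cases j) (simp_all add: sum.distrib sum.inter_filter[OF T(1)] cong: if_cong)
qed

text \<open>The members of \<open>U \<inter> C\<close> are adjacent to every other vertex of the
  clique, so \<open>c\<close> in \<open>C\<close> is a common neighbour of \<open>U\<close> exactly
  if it lies in the anchor set of \<open>U - C\<close> but not in \<open>U\<close>.\<close>

lemma size_count_bad:
  assumes R: "finite R" and T: "finite T" "\<And>U. U \<subseteq> R \<Longrightarrow> anchor cl C (U - C) \<in> T" and C: "C \<subseteq> R"
    and clq: "\<And>a b. a \<in> C \<Longrightarrow> b \<in> C \<Longrightarrow> cl a b"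
  shows "(\<Sum>A\<in>T. size_count (blocked cl C R A) j) =
    size_count {U. U \<subseteq> R \<and> \<not> (\<exists>c\<in>C. \<forall>u\<in>U. cl u c \<and> u \<noteq> c)} j"
proof -
  have "{U. U \<subseteq> R \<and> \<not> (\<exists>c\<in>C. \<forall>u\<in>U. cl u c \<and> u \<noteq> c)} = (\<Union>A\<in>T. blocked cl C R A)"
  proof (intro equalityI subsetI)
    fix U assume U: "U \<in> {U. U \<subseteq> R \<and> \<not> (\<exists>c\<in>C. \<forall>u\<in>U. cl u c \<and> u \<noteq> c)}"
    have "anchor cl C (U - C) \<subseteq> U"
    proof
      fix c assume c: "c \<in> anchor cl C (U - C)"
      then have "c \<in> C" by (auto simp: anchor_def)
      with U obtain u where "u \<in> U" "\<not> (cl u c \<and> u \<noteq> c)" by blast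
      then show "c \<in> U" using c clq by (cases "u \<in> C") (auto simp: anchor_def)
    qed
    then have "U \<in> blocked cl C R (anchor cl C (U - C))" using U by (auto simp: blocked_def)
    then show "U \<in> (\<Union>A\<in>T. blocked cl C R A)" using T(2) U by blast
  next
    fix U assume "U \<in> (\<Union>A\<in>T. blocked cl C R A)"
    then have U: "U \<subseteq> R" "anchor cl C (U - C) \<inter> R \<subseteq> U" by (auto simp: blocked_def)
    have "\<not> (\<forall>u\<in>U. cl u c \<and> u \<noteq> c)" if "c \<in> C" for c
    proof
      assume *: "\<forall>u\<in>U. cl u c \<and> u \<noteq> c"
      then have "c \<in> anchor cl C (U - C)" using that by (auto simp: anchor_def)
      then have "c \<in> U" using U C that by blast
      then show False using * by blast
    qed
    then show "U \<in> {U. U \<subseteq> R \<and> \<not> (\<exists>c\<in>C. \<forall>u\<in>U. cl u c \<and> u \<noteq> c)}" using U by blast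
  qed
  then show ?thesis
    by (simp add: size_count_UNION[OF T(1)] finite_blocked[OF R] blocked_disjoint)
qed

text \<open>A set of size \<open>card C + 1\<close> blocked with anchor set \<open>C\<close>
  consists of \<open>C\<close> and one vertex adjacent to all of \<open>C\<close>. A single cell of
  the finished table thus tells whether \<open>C\<close> keeps a common neighbour after the
  removal.\<close>

lemma size_count_blocked_self_eq_0:
  assumes R: "finite R" and C: "C \<subseteq> R" and sym: "\<And>a b. cl a b \<Longrightarrow> cl b a"
  shows "size_count (blocked cl C R C) (Suc (card C)) = 0 \<longleftrightarrow> \<not> (\<exists>w\<in>R. \<forall>c\<in>C. cl c w \<and> c \<noteq> w)"
proof -
  have finC: "finite C" using C R finite_subset by blast
  have "size_count (blocked cl C R C) (Suc (card C)) = 0 \<longleftrightarrow>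
      \<not> (\<exists>U. U \<in> blocked cl C R C \<and> card U = Suc (card C))"
    using finite_blocked[OF R, of cl C C] by (auto simp: size_count_def)
  also have "(\<exists>U. U \<in> blocked cl C R C \<and> card U = Suc (card C)) \<longleftrightarrow> (\<exists>w\<in>R. \<forall>c\<in>C. cl c w \<and> c \<noteq> w)"
  proof
    assume "\<exists>U. U \<in> blocked cl C R C \<and> card U = Suc (card C)"
    then obtain U where U: "U \<subseteq> R" "anchor cl C (U - C) = C" "C \<subseteq> U" "card U = Suc (card C)"
      using C unfolding blocked_def by (metis (mono_tags, lifting) inf.absorb1 mem_Collect_eq)
    then have "card (U - C) = 1" using finC by (simp add: card_Diff_subset)
    then obtain w where w: "U - C = {w}" by (auto simp: card_1_singleton_iff)
    have "cl w c" if "c \<in> C" for c using U(2) w that by (auto simp: anchor_def)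
    then show "\<exists>w\<in>R. \<forall>c\<in>C. cl c w \<and> c \<noteq> w"
      using U w sym by (intro bexI[of _ w]) auto
  next
    assume "\<exists>w\<in>R. \<forall>c\<in>C. cl c w \<and> c \<noteq> w"
    then obtain w where w: "w \<in> R" "\<forall>c\<in>C. cl c w \<and> c \<noteq> w" by blast
    then have "w \<notin> C" by auto
    then have "insert w C - C = {w}" by auto
    then have "insert w C \<in> blocked cl C R C"
      using w C sym by (auto simp: blocked_def anchor_def)
    then show "\<exists>U. U \<in> blocked cl C R C \<and> card U = Suc (card C)"
      using finC \<open>w \<notin> C\<close> by (intro exI[of _ "insert w C"]) auto
  qed
  finally show ?thesis .
qed

text \<open>
  Removing a simplicial vertex \<open>v\<close> with neighbourhood \<open>C\<close>: a proper subset of \<open>C\<close> has a common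
  neighbour in \<open>C\<close>, so \<open>C\<close> is the only set avoiding \<open>v\<close> that can leave the complex.
\<close>

lemma common_nbr_sets_insert:
  assumes v: "v \<notin> R" and C: "C = {u \<in> R. cl v u}"
    and clq: "\<And>a b. a \<in> C \<Longrightarrow> b \<in> C \<Longrightarrow> cl a b" and sym: "\<And>a b. cl a b \<Longrightarrow> cl b a"
  shows "common_nbr_sets cl (insert v R) = common_nbr_sets cl R \<union>
    (if \<exists>w\<in>R. \<forall>c\<in>C. cl c w \<and> c \<noteq> w then {} else {C}) \<union>
    insert v ` {U. U \<subseteq> R \<and> (\<exists>c\<in>C. \<forall>u\<in>U. cl u c \<and> u \<noteq> c)}" (is "?L = ?R1 \<union> ?R2 \<union> insert v ` ?R3")
proof (intro equalityI subsetI)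
  fix U assume U: "U \<in> ?L"
  then obtain w where w: "w \<in> insert v R" "\<forall>u\<in>U. cl u w \<and> u \<noteq> w" and Us: "U \<subseteq> insert v R"
    by (auto simp: common_nbr_sets_def)
  show "U \<in> ?R1 \<union> ?R2 \<union> insert v ` ?R3"
  proof (cases "v \<in> U")
    case True
    then have "w \<in> C" using w C by auto
    then have "U - {v} \<in> ?R3" using w Us by auto
    then have "insert v (U - {v}) \<in> insert v ` ?R3" by (rule imageI)
    moreover have "insert v (U - {v}) = U" using True by auto
    ultimately show ?thesis by simp
  next
    case False
    then have UR: "U \<subseteq> R" using Us by auto
    show ?thesis
    proof (cases "w = v")
      case False
      then show ?thesis using w UR by (auto simp: common_nbr_sets_def)
    next
      case True
      then have UC: "U \<subseteq> C" using w UR C sym by auto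
      show ?thesis
      proof (cases "U = C")
        case True
        then show ?thesis using UR by (auto simp: common_nbr_sets_def)
      next
        case False
        then obtain c where "c \<in> C" "c \<notin> U" using UC by auto
        then have "\<forall>u\<in>U. cl u c \<and> u \<noteq> c" using clq UC by blast
        then show ?thesis using UR \<open>c \<in> C\<close> C by (auto simp: common_nbr_sets_def)
      qed
    qed
  qed
next
  fix U assume "U \<in> ?R1 \<union> ?R2 \<union> insert v ` ?R3"
  then consider "U \<in> ?R1" | "U = C" | "U \<in> insert v ` ?R3" by (auto split: if_splits)
  then show "U \<in> ?L"
  proof cases
    case 1
    then show ?thesis by (auto simp: common_nbr_sets_def)
  next
    case 2
    then show ?thesis using C v sym by (auto simp: common_nbr_sets_def)
  next
    case 3
    then show ?thesis using C v by (auto simp: common_nbr_sets_def)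
  qed
qed

text \<open>The complex grows like the power set, minus the bad sets enlarged by \<open>v\<close>,
  plus possibly \<open>C\<close>. Everything is moved to the side where it is added, so no natural
  number subtraction occurs. Over all removals the power set terms telescope to the number of
  nonempty vertex sets.\<close>

lemma size_count_common_nbr_sets_insert:
  assumes R: "finite R" and v: "v \<notin> R" and C: "C = {u \<in> R. cl v u}"
    and clq: "\<And>a b. a \<in> C \<Longrightarrow> b \<in> C \<Longrightarrow> cl a b" and sym: "\<And>a b. cl a b \<Longrightarrow> cl b a"
    and T: "finite T" "\<And>U. U \<subseteq> R \<Longrightarrow> anchor cl C (U - C) \<in> T"
  shows "size_count (common_nbr_sets cl (insert v R)) j +
      (if j = 0 then 0 else \<Sum>A\<in>T. size_count (blocked cl C R A) (j - 1)) + size_count (Pow R) j =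
    size_count (common_nbr_sets cl R) j + size_count (Pow (insert v R)) j +
      (if j = card C \<and> size_count (blocked cl C R C) (Suc (card C)) = 0 then 1 else 0)"
proof -
  let ?bad = "{U. U \<subseteq> R \<and> \<not> (\<exists>c\<in>C. \<forall>u\<in>U. cl u c \<and> u \<noteq> c)}"
  let ?good = "{U. U \<subseteq> R \<and> (\<exists>c\<in>C. \<forall>u\<in>U. cl u c \<and> u \<noteq> c)}"
  let ?new = "if \<exists>w\<in>R. \<forall>c\<in>C. cl c w \<and> c \<noteq> w then {} else {C}"
  have CR: "C \<subseteq> R" using C by auto
  have fin: "finite ?bad" "finite ?good" "finite (common_nbr_sets cl R)"
    by (rule finite_subset[of _ "Pow R"]; use R in \<open>auto simp: common_nbr_sets_def\<close>)+
  have "size_count (common_nbr_sets cl (insert v R)) j =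
      size_count (common_nbr_sets cl R \<union> ?new) j + size_count (insert v ` ?good) j"
  proof -
    have "common_nbr_sets cl (insert v R) = common_nbr_sets cl R \<union> ?new \<union> insert v ` ?good"
      by (rule common_nbr_sets_insert[of v R C cl, OF v C]) (use clq sym in blast)+
    moreover have "size_count (common_nbr_sets cl R \<union> ?new \<union> insert v ` ?good) j =
        size_count (common_nbr_sets cl R \<union> ?new) j + size_count (insert v ` ?good) j"
      by (rule size_count_Un) (use fin v CR in \<open>auto simp: common_nbr_sets_def\<close>)
    ultimately show ?thesis by simp
  qed
  also have "size_count (common_nbr_sets cl R \<union> ?new) j = size_count (common_nbr_sets cl R) j + size_count ?new j"
    by (rule size_count_Un) (use fin in \<open>auto simp: common_nbr_sets_def\<close>)
  also have "size_count (insert v ` ?good) j = (if j = 0 then 0 else size_count ?good (j - 1))"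
    by (rule size_count_insert_image[OF R _ v]) auto
  also have "size_count ?new j = (if j = card C \<and> size_count (blocked cl C R C) (Suc (card C)) = 0 then 1 else 0)"
  proof -
    have "size_count (blocked cl C R C) (Suc (card C)) = 0 \<longleftrightarrow> \<not> (\<exists>w\<in>R. \<forall>c\<in>C. cl c w \<and> c \<noteq> w)"
      by (rule size_count_blocked_self_eq_0) (use R CR sym in blast)+
    moreover have "{U \<in> {C}. card U = j} = (if j = card C then {C} else {})" by auto
    then have "size_count {C} j = (if j = card C then 1 else 0)" "size_count {} j = 0"
      unfolding size_count_def by (simp_all del: singleton_conv2)
    ultimately show ?thesis by (auto simp del: not_gr_zero)
  qed
  finally have 1: "size_count (common_nbr_sets cl (insert v R)) j = size_count (common_nbr_sets cl R) j +
      (if j = card C \<and> size_count (blocked cl C R C) (Suc (card C)) = 0 then 1 else 0) +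
      (if j = 0 then 0 else size_count ?good (j - 1))" .
  have "size_count (Pow (insert v R)) j = size_count (Pow R) j + size_count (insert v ` Pow R) j"
    unfolding Pow_insert by (rule size_count_Un) (use R v in auto)
  also have "size_count (insert v ` Pow R) j = (if j = 0 then 0 else size_count (Pow R) (j - 1))"
    by (rule size_count_insert_image[OF R _ v]) auto
  finally have 2: "size_count (Pow (insert v R)) j =
      size_count (Pow R) j + (if j = 0 then 0 else size_count (Pow R) (j - 1))" .
  have "Pow R = ?good \<union> ?bad" by auto
  then have 3: "size_count (Pow R) (j - 1) = size_count ?good (j - 1) + size_count ?bad (j - 1)"
    using size_count_Un[OF fin(2,1), of "j - 1"] by fastforce
  have 4: "(\<Sum>A\<in>T. size_count (blocked cl C R A) (j - 1)) = size_count ?bad (j - 1)"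
    by (rule size_count_bad[OF R T(1) _ CR]) (use T(2) clq in blast)+
  show ?thesis unfolding 1 2 4 using 3 by simp
qed

section \<open>Reasoning about programs\<close>

primrec wvars :: "com \<Rightarrow> string set" where
  "wvars Skip = {}"
| "wvars (Assign x e) = {x}"
| "wvars (Write a i e) = {}"
| "wvars (Seq c1 c2) = wvars c1 \<union> wvars c2"
| "wvars (If b c1 c2) = wvars c1 \<union> wvars c2"
| "wvars (While b c) = wvars c"

primrec warrs :: "com \<Rightarrow> string set" where
  "warrs Skip = {}"
| "warrs (Assign x e) = {}"
| "warrs (Write a i e) = {a}"
| "warrs (Seq c1 c2) = warrs c1 \<union> warrs c2"
| "warrs (If b c1 c2) = warrs c1 \<union> warrs c2"
| "warrs (While b c) = warrs c"

definition same :: "string set \<Rightarrow> string set \<Rightarrow> state \<Rightarrow> state \<Rightarrow> bool" where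
  "same V A s s' \<longleftrightarrow> (\<forall>x. x \<notin> V \<longrightarrow> vars s' x = vars s x) \<and> (\<forall>a. a \<notin> A \<longrightarrow> arrays s' a = arrays s a)"

lemma exec_same: "exec c s t s' \<Longrightarrow> same (wvars c) (warrs c) s s'"
  by (induction rule: exec.induct) (auto simp: same_def)

text \<open>Total correctness with a time budget; since \<open>exec\<close> is deterministic, the
  existential form loses nothing.\<close>

definition run :: "com \<Rightarrow> state \<Rightarrow> nat \<Rightarrow> (state \<Rightarrow> bool) \<Rightarrow> bool" where
  "run c s T Q \<longleftrightarrow> (\<exists>t s'. exec c s t s' \<and> t \<le> T \<and> Q s')"

text \<open>Besides weakening, this hands the frame information of \<open>exec_same\<close> to the
  new postcondition; this is how facts about untouched variables and arrays survive a call.\<close>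

lemma run_conseq:
  assumes "run c s T P" "T \<le> T'" "\<And>s'. same (wvars c) (warrs c) s s' \<Longrightarrow> P s' \<Longrightarrow> Q s'"
  shows "run c s T' Q"
  using assms exec_same unfolding run_def by (meson le_trans)

lemma exec_pos: "exec c s t s' \<Longrightarrow> 0 < t"
  by (induction rule: exec.induct) auto

lemma run_Skip: "Q s \<Longrightarrow> 1 \<le> T \<Longrightarrow> run Skip s T Q"
  unfolding run_def using exec_Skip by blast

lemma run_Assign:
  "Q (s\<lparr>vars := (vars s)(x := aval e s)\<rparr>) \<Longrightarrow> 1 + acost e \<le> T \<Longrightarrow> run (Assign x e) s T Q"
  unfolding run_def using exec_Assign by blast

lemma run_Write:
  "Q (s\<lparr>arrays := (arrays s)(a := (arrays s a)(aval i s := aval e s))\<rparr>) \<Longrightarrow>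
   1 + acost i + acost e \<le> T \<Longrightarrow> run (Write a i e) s T Q"
  unfolding run_def using exec_Write by blast

text \<open>
  The bound acts as a budget. Truncation of the remaining budget is harmless, since every
  execution takes at least one time unit.
\<close>

lemma run_Seq:
  assumes "run c1 s T1 (\<lambda>s'. run c2 s' (T - T1) Q)"
  shows "run (Seq c1 c2) s T Q"
proof -
  obtain t1 s1 t2 s2 where *: "exec c1 s t1 s1" "t1 \<le> T1" "exec c2 s1 t2 s2" "t2 \<le> T - T1" "Q s2"
    using assms by (auto simp: run_def)
  moreover have "0 < t2" using exec_pos *(3) .
  ultimately show ?thesis unfolding run_def
    by (intro exI[of _ "t1 + t2"] exI[of _ s2]) (auto intro: exec_Seq)
qed

lemma run_call:
  assumes "run c1 s T1 P" "\<And>s'. same (wvars c1) (warrs c1) s s' \<Longrightarrow> P s' \<Longrightarrow> run c2 s' (T - T1) Q"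
  shows "run (Seq c1 c2) s T Q"
  by (rule run_Seq, rule run_conseq[OF assms(1)]) (use assms(2) in auto)

lemma run_Assign_Seq:
  "run c (s\<lparr>vars := (vars s)(x := aval e s)\<rparr>) (T - (1 + acost e)) Q \<Longrightarrow> run (Seq (Assign x e) c) s T Q"
  by (rule run_Seq[where ?T1.0 = "1 + acost e"]) (simp add: run_Assign)

lemma run_Write_Seq:
  "run c (s\<lparr>arrays := (arrays s)(a := (arrays s a)(aval i s := aval e s))\<rparr>) (T - (1 + acost i + acost e)) Q \<Longrightarrow>
   run (Seq (Write a i e) c) s T Q"
  by (rule run_Seq[where ?T1.0 = "1 + acost i + acost e"]) (simp add: run_Write)

lemma run_If:
  assumes "bval b s \<Longrightarrow> run c1 s (T - (1 + bcost b)) Q" "\<not> bval b s \<Longrightarrow> run c2 s (T - (1 + bcost b)) Q"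
  shows "run (If b c1 c2) s T Q"
proof (cases "bval b s")
  case True
  with assms(1) obtain t s' where *: "exec c1 s t s'" "t \<le> T - (1 + bcost b)" "Q s'" by (auto simp: run_def)
  moreover have "0 < t" using exec_pos *(1) .
  ultimately show ?thesis unfolding run_def
    by (intro exI[of _ "1 + bcost b + t"] exI[of _ s']) (auto intro: exec_If_True[OF True, simplified])
next
  case False
  with assms(2) obtain t s' where *: "exec c2 s t s'" "t \<le> T - (1 + bcost b)" "Q s'" by (auto simp: run_def)
  moreover have "0 < t" using exec_pos *(1) .
  ultimately show ?thesis unfolding run_def
    by (intro exI[of _ "1 + bcost b + t"] exI[of _ s']) (auto intro: exec_If_False[OF False, simplified])
qed

definition For :: "string \<Rightarrow> aexp \<Rightarrow> com \<Rightarrow> com" where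
  "For x e c = Seq (Assign x (Const 0))
     (While (Less (Var x) e) (Seq c (Assign x (Add (Var x) (Const 1)))))"

lemma wvars_For [simp]: "wvars (For x e c) = insert x (wvars c)"
  and warrs_For [simp]: "warrs (For x e c) = warrs c"
  by (auto simp: For_def)

text \<open>One round costs the body, \<open>acost e + 3\<close> for the test and 4 for the
  increment, hence the summand 7; the factor \<open>N + 1\<close> also pays for the initial
  assignment and the final test. The invariant is required after the increment, so that its index
  agrees with the loop variable.\<close>

lemma run_For:
  assumes e: "\<And>s'. same (insert x (wvars c)) (warrs c) s s' \<Longrightarrow> aval e s' = N"
    and x: "x \<notin> wvars c"
    and I0: "I 0 (s\<lparr>vars := (vars s)(x := 0)\<rparr>)"
    and step: "\<And>i s'. i < N \<Longrightarrow> I i s' \<Longrightarrow> vars s' x = i \<Longrightarrow>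
      same (insert x (wvars c)) (warrs c) s s' \<Longrightarrow>
      run c s' T (\<lambda>s''. I (Suc i) (s''\<lparr>vars := (vars s'')(x := Suc i)\<rparr>))"
  shows "run (For x e c) s ((N + 1) * (T + acost e + 7)) (\<lambda>s'. I N s' \<and> vars s' x = N)"
proof -
  let ?S = "same (insert x (wvars c)) (warrs c) s"
  let ?w = "While (Less (Var x) e) (Seq c (Assign x (Add (Var x) (Const 1))))"
  have loop: "\<exists>t s''. exec ?w s' t s'' \<and> t \<le> m * (T + acost e + 7) + acost e + 3 \<and> I N s'' \<and> vars s'' x = N"
    if "m = N - i" "i \<le> N" "I i s'" "vars s' x = i" "?S s'" for m i s'
    using that
  proof (induction m arbitrary: i s')
    case 0
    then have "\<not> bval (Less (Var x) e) s'" using e by simp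
    from exec_While_False[OF this] 0 show ?case by force
  next
    case (Suc m)
    then have b: "bval (Less (Var x) e) s'" and i: "i < N" using e by auto
    obtain t1 s1 where 1: "exec c s' t1 s1" "t1 \<le> T" "I (Suc i) (s1\<lparr>vars := (vars s1)(x := Suc i)\<rparr>)"
      using step[OF i Suc.prems(3-5)] by (auto simp: run_def)
    have s1: "same (wvars c) (warrs c) s' s1" using exec_same 1(1) .
    then have x1: "vars s1 x = i" using x Suc.prems(4) by (simp add: same_def)
    let ?s2 = "s1\<lparr>vars := (vars s1)(x := Suc i)\<rparr>"
    have body: "exec (Seq c (Assign x (Add (Var x) (Const 1)))) s' (t1 + 4) ?s2"
      using exec_Seq[OF 1(1) exec_Assign[of x "Add (Var x) (Const 1)" s1]] x1
      by (simp add: eval_nat_numeral)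
    have "?S ?s2" using Suc.prems(5) s1 unfolding same_def by simp
    then obtain t2 s3 where 3: "exec ?w ?s2 t2 s3" "t2 \<le> m * (T + acost e + 7) + acost e + 3" "I N s3" "vars s3 x = N"
      using Suc.IH[OF _ _ 1(3)] Suc.prems(1) i by (metis (no_types, lifting) Suc_diff_Suc Suc_leI diff_Suc_1 fun_upd_same
          select_convs(1) surjective update_convs(1))
    have "exec ?w s' (1 + bcost (Less (Var x) e) + (t1 + 4) + t2) s3"
      by (rule exec_While_True[OF b body 3(1)])
    then show ?case using 1 3 by (intro exI[of _ s3] exI) (auto simp: algebra_simps)
  qed
  have "?S (s\<lparr>vars := (vars s)(x := 0)\<rparr>)" by (simp add: same_def)
  then obtain t s'' where "exec ?w (s\<lparr>vars := (vars s)(x := 0)\<rparr>) t s''"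
    "t \<le> N * (T + acost e + 7) + acost e + 3" "I N s''" "vars s'' x = N"
    using loop[of N 0, OF _ _ I0] by auto
  with exec_Seq[OF exec_Assign[of x "Const 0" s]] show ?thesis
    unfolding run_def For_def by (intro exI conjI) (auto simp: algebra_simps)
qed

section \<open>Precomputed tables\<close>

text \<open>\<open>row\<close> holds the multiples of \<open>n\<close>, as the machine cannot
  multiply. \<open>init_tables\<close> sets the diagonal of \<open>adj\<close> to 1, so that
  afterwards the test decides the reflexive closure \<open>cl\<close>.\<close>

definition Adj :: "string \<Rightarrow> string \<Rightarrow> bexp" where
  "Adj x y = Equal (Read ''adj'' (Add (Read ''row'' (Var x)) (Var y))) (Const 1)"

text \<open>\<open>wt\<close> arises by doubling. Its entries below \<open>n\<close> are the
  contributions of single vertices to the number of a set; entry \<open>n\<close> is the length of a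
  memory block that holds one full table of counts.\<close>

definition init_tables :: com where
  "init_tables = Seq (Write ''wt'' (Const 0) (Add (Var ''n'') (Const 2)))
    (For ''i'' (Var ''n'')
      (Seq (Write ''row'' (Add (Var ''i'') (Const 1)) (Add (Read ''row'' (Var ''i'')) (Var ''n'')))
      (Seq (Write ''wt'' (Add (Var ''i'') (Const 1)) (Add (Read ''wt'' (Var ''i'')) (Read ''wt'' (Var ''i''))))
      (Seq (Write ''adj'' (Add (Read ''row'' (Var ''i'')) (Var ''i'')) (Const 1))
           (Write ''alive'' (Var ''i'') (Const 1))))))"

text \<open>\<open>f\<close> is \<open>Add\<close> when the vertex enters the remaining set and
  \<open>Sub\<close> when it leaves; exactly the pairs with the vertex in \<open>N[x] - N[a]\<close>
  are affected.\<close>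

definition update_D :: "(aexp \<Rightarrow> aexp \<Rightarrow> aexp) \<Rightarrow> string \<Rightarrow> com" where
  "update_D f b = For ''x'' (Var ''n'') (For ''a'' (Var ''n'')
    (If (And (Adj ''x'' b) (Not (Adj ''a'' b)))
      (Write ''D'' (Add (Read ''row'' (Var ''x'')) (Var ''a''))
        (f (Read ''D'' (Add (Read ''row'' (Var ''x'')) (Var ''a''))) (Const 1)))
      Skip))"

definition init_D :: com where
  "init_D = For ''b'' (Var ''n'') (update_D Add ''b'')"

text \<open>Running through the degrees downwards allows the triangle to be computed in a single
  row. The last write removes the empty set, which no removal examines; it enters the count as
  \<open>C = {}\<close> when the last vertex goes.\<close>

definition pascal :: com where
  "pascal = Seq (Write ''out'' (Const 0) (Const 1))
    (Seq (For ''i'' (Var ''n'') (For ''j'' (Var ''n'')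
      (Write ''out'' (Sub (Var ''n'') (Var ''j''))
        (Add (Read ''out'' (Sub (Var ''n'') (Var ''j'')))
             (Read ''out'' (Sub (Sub (Var ''n'') (Var ''j'')) (Const 1)))))))
    (Write ''out'' (Const 0) (Const 0)))"

text \<open>A vertex \<open>x\<close> is simplicial iff \<open>N[x]\<close> is contained in
  \<open>N[a]\<close> for each remaining neighbour \<open>a\<close>, that is, iff these deficits
  vanish. There is no early exit; a later simplicial vertex simply overwrites
  \<open>v\<close>.\<close>

definition find_simplicial :: com where
  "find_simplicial = For ''x'' (Var ''n'')
    (If (Equal (Read ''alive'' (Var ''x'')) (Const 1))
      (Seq (Assign ''ok'' (Const 1))
      (Seq (For ''a'' (Var ''n'')
        (If (And (Equal (Read ''alive'' (Var ''a'')) (Const 1)) (And (Adj ''x'' ''a'')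
            (Not (Equal (Read ''D'' (Add (Read ''row'' (Var ''x'')) (Var ''a''))) (Const 0)))))
          (Assign ''ok'' (Const 0)) Skip))
      (If (Equal (Var ''ok'') (Const 1)) (Assign ''v'' (Var ''x'')) Skip)))
      Skip)"

definition encode :: "string \<Rightarrow> bexp \<Rightarrow> com" where
  "encode b P = Seq (Assign b (Const 0)) (For ''u'' (Var ''n'')
    (If P (Assign b (Add (Var b) (Read ''wt'' (Var ''u'')))) Skip))"

text \<open>The machine cannot extract bits of an address in constant time, so the members of an
  encoded set are recorded in \<open>mem\<close> next to its address.\<close>

definition mark :: "string \<Rightarrow> bexp \<Rightarrow> com" where
  "mark b P = For ''u'' (Var ''n'') (If P (Write ''mem'' (Add (Var b) (Var ''u'')) (Const 1)) Skip)"

definition count_marked :: "string \<Rightarrow> bexp \<Rightarrow> com" where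
  "count_marked z P = Seq (Assign z (Const 0)) (For ''u'' (Var ''n'')
    (If P (Assign z (Add (Var z) (Const 1))) Skip))"

definition add_row :: com where
  "add_row = For ''j'' (Add (Var ''n'') (Const 1))
    (Write ''cnt'' (Add (Var ''p'') (Var ''j''))
      (Add (Read ''cnt'' (Add (Var ''p'') (Var ''j''))) (Read ''cnt'' (Add (Var ''q'') (Var ''j'')))))"

definition env :: "nat \<Rightarrow> (nat \<Rightarrow> nat \<Rightarrow> bool) \<Rightarrow> state \<Rightarrow> bool" where
  "env n cl s \<longleftrightarrow> vars s ''n'' = n \<and> (\<forall>i<n. arrays s ''row'' i = i * n) \<and>
     (\<forall>i<n. \<forall>j<n. arrays s ''adj'' (i * n + j) = (if cl i j then 1 else 0)) \<and>
     (\<forall>i\<le>n. arrays s ''wt'' i = (n + 2) * 2 ^ i)"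

lemma env_cong:
  assumes "env n cl s" "vars s' ''n'' = vars s ''n''" "arrays s' ''row'' = arrays s ''row''"
    "arrays s' ''adj'' = arrays s ''adj''" "arrays s' ''wt'' = arrays s ''wt''"
  shows "env n cl s'"
  using assms by (simp add: env_def)

lemma wvars_fragments [simp]:
  "wvars (update_D f b) = {''x'', ''a''}" "warrs (update_D f b) = {''D''}"
  "wvars (encode b P) = {b, ''u''}" "warrs (encode b P) = {}"
  "wvars (mark b P) = {''u''}" "warrs (mark b P) = {''mem''}"
  "wvars (count_marked b P) = {b, ''u''}" "warrs (count_marked b P) = {}"
  "wvars add_row = {''j''}" "warrs add_row = {''cnt''}"
  "wvars find_simplicial = {''x'', ''a'', ''ok'', ''v''}" "warrs find_simplicial = {}"
  "wvars init_tables = {''i''}" "warrs init_tables = {''wt'', ''row'', ''adj'', ''alive''}"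
  "wvars init_D = {''b'', ''x'', ''a''}" "warrs init_D = {''D''}"
  "wvars pascal = {''i'', ''j''}" "warrs pascal = {''out''}"
  by (auto simp: update_D_def encode_def mark_def count_marked_def add_row_def find_simplicial_def
      init_tables_def init_D_def pascal_def)

lemma bval_Adj: "env n cl s \<Longrightarrow> vars s x < n \<Longrightarrow> vars s y < n \<Longrightarrow> bval (Adj x y) s \<longleftrightarrow> cl (vars s x) (vars s y)"
  by (simp add: Adj_def env_def)

lemma bcost_Adj [simp]: "bcost (Adj x y) = 7"
  by (simp add: Adj_def)

definition alive :: "nat \<Rightarrow> nat set \<Rightarrow> state \<Rightarrow> bool" where
  "alive n R s \<longleftrightarrow> (\<forall>u<n. arrays s ''alive'' u = 1 \<longleftrightarrow> u \<in> R)"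

lemma index_inj: "i * n + j = i' * n + j' \<longleftrightarrow> i = i' \<and> j = j'" if "j < n" "j' < (n::nat)"
proof
  assume "i * n + j = i' * n + j'"
  then have "(i * n + j) div n = (i' * n + j') div n" "(i * n + j) mod n = (i' * n + j') mod n" by simp_all
  then show "i = i' \<and> j = j'" using that by simp
qed simp

lemma run_update_D:
  assumes env: "env n cl s" and b: "vars s b < n" "b \<noteq> ''x''" "b \<noteq> ''a''"
    and f: "\<And>e s. aval (f e (Const 1)) s = g (aval e s)" "\<And>e. acost (f e (Const 1)) = acost e + 2"
  shows "run (update_D f b) s ((n + 1) * ((n + 1) * 100)) (\<lambda>s'. \<forall>x<n. \<forall>a<n. arrays s' ''D'' (x * n + a) =
    (if cl x (vars s b) \<and> \<not> cl a (vars s b) then g (arrays s ''D'' (x * n + a)) else arrays s ''D'' (x * n + a)))"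
proof -
  let ?d = "\<lambda>x a. arrays s ''D'' (x * n + a)"
  let ?c = "\<lambda>x a. cl x (vars s b) \<and> \<not> cl a (vars s b)"
  let ?inner = "For ''a'' (Var ''n'')
    (If (And (Adj ''x'' b) (Not (Adj ''a'' b)))
      (Write ''D'' (Add (Read ''row'' (Var ''x'')) (Var ''a''))
        (f (Read ''D'' (Add (Read ''row'' (Var ''x'')) (Var ''a''))) (Const 1)))
      Skip)"
  have inner: "run ?inner s1 ((n + 1) * 60) (\<lambda>s'. \<forall>y<n. \<forall>a<n. arrays s' ''D'' (y * n + a) =
        (if y < Suc x \<and> ?c y a then g (?d y a) else ?d y a))"
    if x: "x < n" "vars s1 ''x'' = x" and env1: "env n cl s1" and b1: "vars s1 b = vars s b"
      and D: "\<forall>y<n. \<forall>a<n. arrays s1 ''D'' (y * n + a) = (if y < x \<and> ?c y a then g (?d y a) else ?d y a)"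
    for x s1
  proof (rule run_conseq[OF run_For[where N = n and T = 40 and
        I = "\<lambda>i s'. \<forall>y<n. \<forall>a<n. arrays s' ''D'' (y * n + a) =
          (if (y < x \<or> y = x \<and> a < i) \<and> ?c y a then g (?d y a) else ?d y a)"]], goal_cases)
    case (1 s')
    then show ?case using env1 by (simp add: same_def env_def)
  next
    case 2
    then show ?case by simp
  next
    case 3
    then show ?case using D by simp
  next
    case (4 i s')
    have env': "env n cl s'" by (rule env_cong[OF env1]) (use 4 in \<open>auto simp: same_def\<close>)
    have vx: "vars s' ''x'' = x" "vars s' b = vars s b" using 4 b1 b x by (auto simp: same_def)
    have row: "arrays s' ''row'' x = x * n" using env' x by (simp add: env_def)
    have cnd: "bval (And (Adj ''x'' b) (Not (Adj ''a'' b))) s' \<longleftrightarrow> ?c x i"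
      using bval_Adj[OF env', of "''x''" b] bval_Adj[OF env', of "''a''" b] vx 4 b x by simp
    show ?case
    proof (rule run_If, goal_cases)
      case 1
      then have c: "?c x i" using cnd by blast
      show ?case
        by (rule run_Write) (use 4 c in \<open>auto simp: f[simplified] vx row index_inj less_Suc_eq\<close>)
    next
      case 2
      then have c: "\<not> ?c x i" using cnd by blast
      show ?case
        by (rule run_Skip) (use 4 c in \<open>auto simp: less_Suc_eq\<close>)
    qed
  next
    case 5
    show ?case by (simp add: algebra_simps)
  next
    case (6 s')
    then show ?case by (auto simp: less_Suc_eq)
  qed
  show ?thesis
    unfolding update_D_def
  proof (rule run_conseq[OF run_For[where N = n and T = "(n + 1) * 60" and
        I = "\<lambda>x s'. \<forall>y<n. \<forall>a<n. arrays s' ''D'' (y * n + a) = (if y < x \<and> ?c y a then g (?d y a) else ?d y a)"]], goal_cases)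
    case (1 s')
    then show ?case using env by (simp add: same_def env_def)
  next
    case 2
    then show ?case by simp
  next
    case 3
    then show ?case by simp
  next
    case (4 i s')
    have env': "env n cl s'" by (rule env_cong[OF env]) (use 4 in \<open>auto simp: same_def\<close>)
    have "vars s' b = vars s b" using 4 b by (auto simp: same_def)
    then show ?case by (rule run_conseq[OF inner[OF 4(1,3) env' _ 4(2)]]) auto
  next
    case 5
    show ?case by (simp add: algebra_simps)
  next
    case (6 s')
    then show ?case by simp
  qed
qed


section \<open>Deficits, binomial coefficients and the search for a simplicial vertex\<close>

definition deficits :: "nat \<Rightarrow> (nat \<Rightarrow> nat \<Rightarrow> bool) \<Rightarrow> nat set \<Rightarrow> state \<Rightarrow> bool" where
  "deficits n cl R s \<longleftrightarrow>
     (\<forall>x<n. \<forall>a<n. arrays s ''D'' (x * n + a) = card {b \<in> R. cl x b \<and> \<not> cl a b})"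

lemma card_Collect_insert:
  assumes "finite R" "v \<notin> R"
  shows "card {b \<in> insert v R. P b} = (if P v then Suc (card {b \<in> R. P b}) else card {b \<in> R. P b})"
proof -
  have "{b \<in> insert v R. P b} = (if P v then insert v {b \<in> R. P b} else {b \<in> R. P b})" by auto
  then show ?thesis using assms by simp
qed

lemma run_init_D:
  assumes env: "env n cl s" and D: "\<And>z. arrays s ''D'' z = 0"
  shows "run init_D s ((n + 1) * ((n + 1) * ((n + 1) * 110))) (deficits n cl {..<n})"
  unfolding init_D_def
proof (rule run_conseq[OF run_For[where N = n and T = "(n + 1) * ((n + 1) * 100)" and
      I = "\<lambda>i. deficits n cl {..<i}"]], goal_cases)
  case (1 s')
  then show ?case using env by (simp add: same_def env_def)
next
  case 2
  then show ?case by (simp add: update_D_def)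
next
  case 3
  then show ?case by (simp add: deficits_def D)
next
  case (4 i s')
  have env': "env n cl s'" by (rule env_cong[OF env]) (use 4 in \<open>auto simp: same_def update_D_def\<close>)
  show ?case
  proof (rule run_conseq[OF run_update_D[OF env', where g = "\<lambda>m. m + 1"]], goal_cases)
    case (7 s'')
    have c: "card {b \<in> {..<Suc i}. cl x b \<and> \<not> cl a b} = (if cl x i \<and> \<not> cl a i
        then card {b \<in> {..<i}. cl x b \<and> \<not> cl a b} + 1 else card {b \<in> {..<i}. cl x b \<and> \<not> cl a b})" for x a
      unfolding lessThan_Suc using card_Collect_insert[of "{..<i}" i "\<lambda>b. cl x b \<and> \<not> cl a b"] by simp
    show ?case using 7(2) 4(2,3) by (simp add: deficits_def c[simplified])
  qed (use 4 in simp_all)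
next
  case 5
  show ?case by (simp add: algebra_simps)
next
  case (6 s')
  then show ?case by simp
qed

lemma run_pascal:
  assumes "vars s ''n'' = n" and out: "\<And>j. arrays s ''out'' j = 0"
  shows "run pascal s ((n + 1) * ((n + 1) * 50))
    (\<lambda>s'. \<forall>j\<le>n. arrays s' ''out'' j = (if j = 0 then 0 else n choose j))"
  unfolding pascal_def
proof (rule run_Write_Seq, rule run_Seq[where ?T1.0 = "(n + 1) * ((n + 1) * 23 + 9)"],
    rule run_conseq[OF run_For[where N = n and T = "(n + 1) * 23" and
      I = "\<lambda>i s'. \<forall>j\<le>n. arrays s' ''out'' j = i choose j"]], goal_cases)
  case (1 s')
  then show ?case using assms by (simp add: same_def)
next
  case 2
  then show ?case by simp
next
  case 3
  then show ?case using out by (auto simp: binomial_eq_0_iff)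
next
  case (4 i s')
  show ?case
  proof (rule run_conseq[OF run_For[where N = n and T = 15 and
      \<comment> \<open>The entries above position \<open>n - j\<close> already belong to the next
        row of the triangle.\<close>
      I = "\<lambda>j s''. \<forall>m\<le>n. arrays s'' ''out'' m = (if n < m + j then Suc i choose m else i choose m)"]], goal_cases)
    case (1 s'')
    then show ?case using assms 4 by (simp add: same_def)
  next
    case 2
    then show ?case by simp
  next
    case 3
    then show ?case using 4 by simp
  next
    case j: (4 j s'')
    have nn: "vars s'' ''n'' = n" using j(4) 4(4) assms by (simp add: same_def)
    have "Suc i choose (n - j) = (i choose (n - j)) + (i choose (n - j - 1))"
      using j(1) by (metis Suc_diff_Suc binomial_Suc_Suc add.commute diff_Suc_1)
    moreover have "arrays s'' ''out'' (n - j - 1) = i choose (n - j - 1)"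
      "arrays s'' ''out'' (n - j) = i choose (n - j)" using j(1,2) by auto
    moreover have "n < m + Suc j \<longleftrightarrow> n < m + j \<or> m = n - j" if "m \<le> n" for m
      using that j(1) by auto
    ultimately show ?case
      using j(2) by (intro run_Write) (simp_all add: nn j(3))
  next
    case 5
    show ?case by (simp add: algebra_simps)
  next
    case (6 s'')
    then show ?case by (auto simp: not_less)
  qed
next
  case 5
  show ?case by (simp add: algebra_simps)
next
  case (6 s')
  then show ?case by (intro run_Write) (auto simp: algebra_simps)
qed

lemma run_find_simplicial:
  assumes env: "env n cl s" and al: "alive n R s" and D: "deficits n cl R s" and R: "R \<subseteq> {..<n}"
    and ex: "\<exists>y\<in>R. \<forall>a\<in>R. \<forall>b\<in>R. cl y a \<longrightarrow> cl y b \<longrightarrow> cl a b"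
  shows "run find_simplicial s ((n + 1) * ((n + 1) * 80))
    (\<lambda>s'. vars s' ''v'' \<in> R \<and> (\<forall>a\<in>R. \<forall>b\<in>R. cl (vars s' ''v'') a \<longrightarrow> cl (vars s' ''v'') b \<longrightarrow> cl a b))"
proof -
  define P where "P y \<longleftrightarrow> y \<in> R \<and> (\<forall>a\<in>R. \<forall>b\<in>R. cl y a \<longrightarrow> cl y b \<longrightarrow> cl a b)" for y
  have finR: "finite R" using R finite_subset by blast
  show ?thesis
    unfolding find_simplicial_def
  proof (rule run_conseq[OF run_For[where N = n and T = "(n + 1) * 60" and
        I = "\<lambda>i s'. (\<exists>y<i. P y) \<longrightarrow> P (vars s' ''v'')"]], goal_cases)
    case (1 s')
    then show ?case using env by (simp add: same_def env_def)
  next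
    case 2
    then show ?case by simp
  next
    case 3
    then show ?case by simp
  next
    case (4 i s')
    have al': "alive n R s'" using al 4(4) by (simp add: same_def alive_def)
    show ?case
    proof (rule run_If, goal_cases)
      case 1
      then have iR: "i \<in> R" using al' 4 by (simp add: alive_def)
      show ?case
      proof (rule run_Assign_Seq, rule run_Seq[where ?T1.0 = "(n + 1) * 38"],
          rule run_conseq[OF run_For[where N = n and T = 30 and
          I = "\<lambda>j s''. vars s'' ''ok'' = (if \<forall>a<j. a \<in> R \<longrightarrow> cl i a \<longrightarrow> (\<forall>b\<in>R. cl i b \<longrightarrow> cl a b) then 1 else 0)"]], goal_cases)
        case (1 s'')
        then show ?case using env 4(4) by (simp add: same_def env_def)
      next
        case 2
        then show ?case by simp
      next
        case 3
        then show ?case by simp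
      next
        case j: (4 j s'')
        have env'': "env n cl s''" by (rule env_cong[OF env]) (use 4(4) j(4) in \<open>auto simp: same_def\<close>)
        have vx: "vars s'' ''x'' = i" using 4(3) j(4) by (simp add: same_def)
        have a: "arrays s'' ''alive'' j = 1 \<longleftrightarrow> j \<in> R"
          using al' j by (simp add: alive_def same_def)
        have row: "arrays s'' ''row'' i = i * n" using env'' 4(1) by (simp add: env_def)
        have "arrays s'' ''D'' (i * n + j) = card {b \<in> R. cl i b \<and> \<not> cl j b}"
          using D j(1,4) 4(1,4) by (simp add: deficits_def same_def)
        then have d: "arrays s'' ''D'' (i * n + j) = 0 \<longleftrightarrow> (\<forall>b\<in>R. cl i b \<longrightarrow> cl j b)"
          using finR by auto
        show ?case
        proof (rule run_If, goal_cases)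
          case 1
          then have "j \<in> R \<and> cl i j \<and> \<not> (\<forall>b\<in>R. cl i b \<longrightarrow> cl j b)"
            using bval_Adj[OF env'', of "''x''" "''a''"] a d vx row j(1,3) 4(1) by simp
          then show ?case by (intro run_Assign) auto
        next
          case 2
          then have "j \<in> R \<longrightarrow> cl i j \<longrightarrow> (\<forall>b\<in>R. cl i b \<longrightarrow> cl j b)"
            using bval_Adj[OF env'', of "''x''" "''a''"] a d vx row j(1,3) 4(1) by auto
          then show ?case using j(2) by (intro run_Skip) (auto simp: less_Suc_eq)
        qed
      next
        case 5
        show ?case by simp
      next
        case (6 s'')
        have vx: "vars s'' ''x'' = i" "vars s'' ''v'' = vars s' ''v''" using 4(3) 6(1) by (simp_all add: same_def)
        have eq: "(\<forall>a<n. a \<in> R \<longrightarrow> cl i a \<longrightarrow> (\<forall>b\<in>R. cl i b \<longrightarrow> cl a b)) \<longleftrightarrow> P i"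
          unfolding P_def using iR subsetD[OF R] by blast
        have ok: "vars s'' ''ok'' = (if P i then 1 else 0)" using 6(2)[unfolded eq] by (rule conjunct1)
        show ?case
        proof (rule run_If, goal_cases)
          case 1
          then have "vars s'' ''ok'' = 1" by simp
          then have "P i" using ok by (metis zero_neq_one)
          then show ?case by (intro run_Assign) (simp_all add: vx)
        next
          case 2
          then have "vars s'' ''ok'' \<noteq> 1" by simp
          then have "\<not> P i" using ok by metis
          then have "(\<exists>y<Suc i. P y) \<longleftrightarrow> (\<exists>y<i. P y)" by (metis less_Suc_eq)
          then show ?case using 4(2) by (intro run_Skip) (simp_all add: vx)
        qed
      qed
    next
      case 2
      then have "\<not> P i" using al' 4 by (simp add: alive_def P_def)
      then show ?case using 4(2) by (intro run_Skip) (auto simp: less_Suc_eq)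
    qed
  next
    case 5
    show ?case by (simp add: algebra_simps)
  next
    case (6 s')
    then show ?case using ex R unfolding P_def by blast
  qed
qed


section \<open>Vertex sets as memory addresses\<close>

definition code :: "nat \<Rightarrow> nat set \<Rightarrow> nat" where
  "code n X = (n + 2) * set_encode X"

text \<open>Division by \<open>n + 2\<close> recovers the set and the offset. Two cells beyond
  \<open>n\<close> offsets are needed because sizes run up to \<open>n\<close> and a row shifted by
  one degree ends at offset \<open>n + 1\<close>.\<close>

lemma code_eq_iff:
  assumes "X \<subseteq> {..<n}" "Y \<subseteq> {..<n}" "i < n + 2" "j < n + 2"
  shows "code n X + i = code n Y + j \<longleftrightarrow> X = Y \<and> i = j"
proof
  assume *: "code n X + i = code n Y + j"
  have "(code n X + i) div (n + 2) = set_encode X" "(code n X + i) mod (n + 2) = i"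
    "(code n Y + j) div (n + 2) = set_encode Y" "(code n Y + j) mod (n + 2) = j"
    using assms(3,4) by (simp_all only: code_def div_mult_self4 mod_mult_self4) simp_all
  then have "set_encode X = set_encode Y" "i = j" using * by metis+
  moreover have "finite X" "finite Y" using assms finite_subset by blast+
  ultimately show "X = Y \<and> i = j" using set_encode_eq by blast
qed simp

lemma set_encode_less: "X \<subseteq> {..<n} \<Longrightarrow> set_encode X < 2 ^ n"
proof -
  assume "X \<subseteq> {..<n}"
  then have "set_encode X \<le> set_encode {..<n}"
    unfolding set_encode_def by (intro sum_mono2) auto
  also have "set_encode {..<n} < 2 ^ n"
    unfolding set_encode_def by (induction n) (auto simp: lessThan_Suc)
  finally show ?thesis .
qed

lemma code_less:
  assumes "X \<subseteq> {..<n}" "i < n + 2"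
  shows "code n X + i < (n + 2) * 2 ^ n"
proof -
  have "(n + 2) * (set_encode X + 1) \<le> (n + 2) * 2 ^ n"
    using set_encode_less[OF assms(1)] by (intro mult_le_mono2) simp
  moreover have "code n X + i < (n + 2) * (set_encode X + 1)" using assms(2) by (simp add: code_def)
  ultimately show ?thesis by linarith
qed

lemma code_empty [simp]: "code n {} = 0"
  by (simp add: code_def)

lemma code_Int_lessThan_Suc:
  "code n (X \<inter> {..<Suc i}) = code n (X \<inter> {..<i}) + (if i \<in> X then (n + 2) * 2 ^ i else 0)"
proof (cases "i \<in> X")
  case True
  then have "X \<inter> {..<Suc i} = insert i (X \<inter> {..<i})" by (auto simp: less_Suc_eq)
  then show ?thesis using True by (simp add: code_def algebra_simps)
next
  case False
  then have "X \<inter> {..<Suc i} = X \<inter> {..<i}" by (auto simp: less_Suc_eq)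
  then show ?thesis using False by simp
qed

lemma run_encode:
  assumes env: "env n cl s" and b: "b \<noteq> ''u''" "b \<noteq> ''n''" and X: "X \<subseteq> {..<n}"
    and P: "\<And>s'. same {b, ''u''} {} s s' \<Longrightarrow> vars s' ''u'' < n \<Longrightarrow> bval P s' \<longleftrightarrow> vars s' ''u'' \<in> X"
      "bcost P \<le> 30"
  shows "run (encode b P) s ((n + 1) * 60) (\<lambda>s'. vars s' b = code n X)"
  unfolding encode_def
proof (rule run_Assign_Seq, rule run_conseq[OF run_For[where N = n and T = 40 and
      I = "\<lambda>i s'. vars s' b = code n (X \<inter> {..<i})"]], goal_cases)
  case (1 s')
  then show ?case using env b by (simp add: same_def env_def)
next
  case 2
  then show ?case using b by simp
next
  case 3
  then show ?case using b by simp
next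
  case (4 i s')
  have "same {b, ''u''} {} s s'" using 4(4) by (auto simp: same_def)
  then have P': "bval P s' \<longleftrightarrow> i \<in> X" using P(1) 4(1,3) by metis
  have wt: "arrays s' ''wt'' i = (n + 2) * 2 ^ i" using env 4(1,4) by (simp add: env_def same_def)
  show ?case
    using 4(2,3) wt P' P(2) b
    by (intro run_If run_Assign run_Skip) (simp_all add: code_Int_lessThan_Suc)
next
  case 5
  show ?case by (simp add: algebra_simps)
next
  case (6 s')
  have "X \<inter> {..<n} = X" using X by auto
  then show ?case using 6 by simp
qed

lemma run_count_marked:
  assumes env: "env n cl s" and b: "b \<noteq> ''u''" "b \<noteq> ''n''" and X: "X \<subseteq> {..<n}"
    and P: "\<And>s'. same {b, ''u''} {} s s' \<Longrightarrow> vars s' ''u'' < n \<Longrightarrow> bval P s' \<longleftrightarrow> vars s' ''u'' \<in> X"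
      "bcost P \<le> 30"
  shows "run (count_marked b P) s ((n + 1) * 60) (\<lambda>s'. vars s' b = card X)"
  unfolding count_marked_def
proof (rule run_Assign_Seq, rule run_conseq[OF run_For[where N = n and T = 40 and
      I = "\<lambda>i s'. vars s' b = card (X \<inter> {..<i})"]], goal_cases)
  case (1 s')
  then show ?case using env b by (simp add: same_def env_def)
next
  case 2
  then show ?case using b by simp
next
  case 3
  then show ?case using b by simp
next
  case (4 i s')
  have "same {b, ''u''} {} s s'" using 4(4) by (auto simp: same_def)
  then have P': "bval P s' \<longleftrightarrow> i \<in> X" using P(1) 4(1,3) by metis
  have "X \<inter> {..<Suc i} = (if i \<in> X then insert i (X \<inter> {..<i}) else X \<inter> {..<i})"
    by (auto simp: less_Suc_eq)
  then have "card (X \<inter> {..<Suc i}) = card (X \<inter> {..<i}) + (if i \<in> X then 1 else 0)" by simp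
  then show ?case
    using 4(2,3) P' P(2) b by (intro run_If run_Assign run_Skip) simp_all
next
  case 5
  show ?case by (simp add: algebra_simps)
next
  case (6 s')
  have "X \<inter> {..<n} = X" using X by auto
  then show ?case using 6 by simp
qed

text \<open>\<open>mem\<close> is shared by all removals and never reset. This is harmless, since
  its intended content depends on the set alone: soundness is demanded for all sets at once and
  survives each marking by injectivity of addresses, while \<open>mem_full\<close> holds for ever
  more sets.\<close>

definition mem_sound :: "nat \<Rightarrow> (nat \<Rightarrow> nat) \<Rightarrow> bool" where
  "mem_sound n f \<longleftrightarrow> (\<forall>X u. X \<subseteq> {..<n} \<longrightarrow> u < n \<longrightarrow> f (code n X + u) = 1 \<longrightarrow> u \<in> X)"

definition mem_full :: "nat \<Rightarrow> (nat \<Rightarrow> nat) \<Rightarrow> nat set \<Rightarrow> bool" where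
  "mem_full n f X \<longleftrightarrow> (\<forall>u\<in>X. f (code n X + u) = 1)"

lemma mem_iff: "mem_sound n f \<Longrightarrow> mem_full n f X \<Longrightarrow> X \<subseteq> {..<n} \<Longrightarrow> u < n \<Longrightarrow> f (code n X + u) = 1 \<longleftrightarrow> u \<in> X"
  by (auto simp: mem_sound_def mem_full_def)

text \<open>The test \<open>P\<close> may itself read \<open>mem\<close> while the loop writes
  there, as \<open>nbh_in_A\<close> does. It is therefore required to be correct in every memory
  that is still sound and has lost no full set.\<close>

lemma run_mark:
  assumes n: "vars s ''n'' = n" and b: "b \<noteq> ''u''" "vars s b = code n X" and X: "X \<subseteq> {..<n}"
    and snd: "mem_sound n (arrays s ''mem'')"
    and P: "\<And>s'. same {''u''} {''mem''} s s' \<Longrightarrow> vars s' ''u'' < n \<Longrightarrow> mem_sound n (arrays s' ''mem'') \<Longrightarrow>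
        (\<And>Y. mem_full n (arrays s ''mem'') Y \<Longrightarrow> mem_full n (arrays s' ''mem'') Y) \<Longrightarrow>
        bval P s' \<longleftrightarrow> vars s' ''u'' \<in> X" "bcost P \<le> 30"
  shows "run (mark b P) s ((n + 1) * 60) (\<lambda>s'. mem_sound n (arrays s' ''mem'') \<and>
    (\<forall>Y. mem_full n (arrays s ''mem'') Y \<longrightarrow> mem_full n (arrays s' ''mem'') Y) \<and> mem_full n (arrays s' ''mem'') X)"
  unfolding mark_def
proof (rule run_conseq[OF run_For[where N = n and T = 40 and
      I = "\<lambda>i s'. mem_sound n (arrays s' ''mem'') \<and>
        (\<forall>z. arrays s ''mem'' z = 1 \<longrightarrow> arrays s' ''mem'' z = 1) \<and>
        (\<forall>u\<in>X. u < i \<longrightarrow> arrays s' ''mem'' (code n X + u) = 1)"]], goal_cases)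
  case (1 s')
  then show ?case using n b by (simp add: same_def)
next
  case 2
  then show ?case by simp
next
  case 3
  then show ?case using snd by simp
next
  case (4 i s')
  have "same {''u''} {''mem''} s s'" using 4(4) by (auto simp: same_def)
  moreover have "mem_full n (arrays s ''mem'') Y \<Longrightarrow> mem_full n (arrays s' ''mem'') Y" for Y
    using 4(2) by (simp add: mem_full_def)
  ultimately have P': "bval P s' \<longleftrightarrow> i \<in> X" using P(1) 4(1,2,3) by metis
  have b': "vars s' b = code n X" using 4(4) b by (simp add: same_def)
  show ?case
  proof (rule run_If, goal_cases)
    case 1
    then have "i \<in> X" using P' by simp
    moreover have "code n Y + u = code n X + i \<longleftrightarrow> Y = X \<and> u = i" if "Y \<subseteq> {..<n}" "u < n" for Y u
      using code_eq_iff[OF that(1) X, of u i] that 4(1) by simp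
    ultimately show ?case using 4(2,3) b' P(2)
      by (intro run_Write) (auto simp: mem_sound_def less_Suc_eq)
  next
    case 2
    then have "i \<notin> X" using P' by simp
    then show ?case using 4(2,3) b' P(2) by (intro run_Skip) (auto simp: less_Suc_eq)
  qed
next
  case 5
  show ?case by (simp add: algebra_simps)
next
  case (6 s')
  then show ?case using X by (auto simp: mem_full_def)
qed

text \<open>\<open>pq\<close> places the source row entirely below the target row, so the loop never
  reads a cell that it has already changed.\<close>

lemma run_add_row:
  assumes n: "vars s ''n'' = n" and pq: "vars s ''q'' + n < vars s ''p''"
  shows "run add_row s ((n + 2) * 60) (\<lambda>s'. arrays s' ''cnt'' = (\<lambda>z.
    if vars s ''p'' \<le> z \<and> z < vars s ''p'' + n + 1
    then arrays s ''cnt'' z + arrays s ''cnt'' (vars s ''q'' + (z - vars s ''p'')) else arrays s ''cnt'' z))"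
  unfolding add_row_def
proof (rule run_conseq[OF run_For[where N = "n + 1" and T = 40 and
      I = "\<lambda>i s'. arrays s' ''cnt'' = (\<lambda>z.
    if vars s ''p'' \<le> z \<and> z < vars s ''p'' + i
    then arrays s ''cnt'' z + arrays s ''cnt'' (vars s ''q'' + (z - vars s ''p'')) else arrays s ''cnt'' z)"]], goal_cases)
  case (1 s')
  then show ?case using n by (simp add: same_def)
next
  case 2
  then show ?case by simp
next
  case 3
  then show ?case by auto
next
  case (4 i s')
  have v: "vars s' ''p'' = vars s ''p''" "vars s' ''q'' = vars s ''q''" using 4(4) by (simp_all add: same_def)
  show ?case
    by (intro run_Write) (use pq 4(1) in \<open>auto simp: 4(2,3) v fun_eq_iff\<close>)
next
  case 5
  show ?case by (simp add: algebra_simps)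
next
  case (6 s')
  then show ?case by simp
qed

section \<open>Counting by anchor sets\<close>

definition nbh_in_A :: bexp where
  "nbh_in_A = And (Equal (Read ''mem'' (Add (Var ''A'') (Var ''u''))) (Const 1)) (Adj ''w'' ''u'')"

text \<open>Finding the successor of a set costs \<open>O(n)\<close>, no more than updating its row.
  The lookup in \<open>known\<close> avoids a search for duplicates, so the list contains each
  anchor set only once.\<close>

definition push :: com where
  "push = Seq (Assign ''A'' (Read ''L'' (Var ''i'')))
    (Seq (encode ''b'' nbh_in_A)
    (Seq (mark ''b'' nbh_in_A)
    (If (Equal (Read ''known'' (Add (Var ''base'') (Var ''b''))) (Const 0))
      (Seq (Write ''known'' (Add (Var ''base'') (Var ''b'')) (Const 1))
      (Seq (Write ''L'' (Var ''m'') (Var ''b''))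
           (Assign ''m'' (Add (Var ''m'') (Const 1)))))
      Skip)))"

text \<open>The unshifted copy is skipped if \<open>w\<close> lies in the anchor set, as a bad set
  may not omit it. The offset 1 in the second target accounts for \<open>w\<close> joining the
  set.\<close>

definition transfer :: com where
  "transfer = Seq (Assign ''q'' (Add (Var ''off'') (Var ''A'')))
    (Seq (If (Equal (Read ''mem'' (Add (Var ''A'') (Var ''w''))) (Const 1)) Skip
           (Seq (Assign ''p'' (Add (Var ''new'') (Var ''A''))) add_row))
    (Seq (Assign ''p'' (Add (Add (Var ''new'') (Var ''b'')) (Const 1))) add_row))"

text \<open>\<open>l\<close> freezes the length of the list: \<open>push\<close> extends it during
  the loop, but the sets appended have empty rows in the old table.\<close>

definition step :: com where
  "step = Seq (Assign ''new'' (Add (Var ''off'') (Read ''wt'' (Var ''n''))))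
    (Seq (Assign ''l'' (Var ''m''))
    (Seq (For ''i'' (Var ''l'') (Seq push transfer))
         (Assign ''off'' (Var ''new''))))"

text \<open>The round \<open>f = 0\<close> treats the vertices outside \<open>C\<close>, the round
  \<open>f = 1\<close> those of \<open>C\<close>. The removed vertex is no longer alive and is
  passed over.\<close>

definition sweep :: com where
  "sweep = For ''f'' (Const 2) (For ''w'' (Var ''n'')
    (If (And (Equal (Read ''alive'' (Var ''w'')) (Const 1))
             (Equal (Read ''adj'' (Add (Read ''row'' (Var ''v'')) (Var ''w''))) (Var ''f'')))
      step Skip))"

text \<open>Before any vertex is decided, the only set is the empty one, and its anchor set is
  \<open>C\<close>: hence the single entry 1, at degree 0 of the row of \<open>C\<close>.\<close>

definition start :: com where
  "start = Seq (Assign ''off'' (Add (Var ''off'') (Read ''wt'' (Var ''n''))))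
    (Seq (Assign ''base'' (Var ''off''))
    (Seq (Write ''L'' (Const 0) (Var ''c''))
    (Seq (Assign ''m'' (Const 1))
    (Seq (Write ''known'' (Add (Var ''base'') (Var ''c'')) (Const 1))
         (Write ''cnt'' (Add (Var ''off'') (Var ''c'')) (Const 1))))))"

definition collect :: com where
  "collect = Seq (If (Equal (Read ''cnt'' (Add (Add (Var ''off'') (Var ''c'')) (Add (Var ''z'') (Const 1)))) (Const 0))
      (Write ''out'' (Var ''z'') (Add (Read ''out'' (Var ''z'')) (Const 1))) Skip)
    (For ''i'' (Var ''m'') (Seq (Assign ''A'' (Read ''L'' (Var ''i'')))
      (For ''j'' (Var ''n'')
        (Write ''out'' (Add (Var ''j'') (Const 1))
          (Sub (Read ''out'' (Add (Var ''j'') (Const 1)))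
               (Read ''cnt'' (Add (Add (Var ''off'') (Var ''A'')) (Var ''j''))))))))"

definition alive_nbh :: bexp where
  "alive_nbh = And (Equal (Read ''alive'' (Var ''u'')) (Const 1)) (Adj ''v'' ''u'')"

text \<open>\<open>v\<close> is declared dead before its neighbourhood is encoded; the adjacency
  test is reflexive and would otherwise put \<open>v\<close> into \<open>C\<close>.\<close>

definition eliminate :: com where
  "eliminate = Seq find_simplicial
    (Seq (Write ''alive'' (Var ''v'') (Const 0))
    (Seq (encode ''c'' alive_nbh)
    (Seq (mark ''c'' alive_nbh)
    (Seq (count_marked ''z'' alive_nbh)
    (Seq start
    (Seq sweep
    (Seq collect
         (update_D Sub ''v''))))))))"

definition nbh_program :: com where
  "nbh_program = Seq init_tables (Seq init_D (Seq pascal (For ''e'' (Var ''n'') eliminate)))"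

lemma wvars_fragments2 [simp]:
  "wvars push = {''A'', ''b'', ''u'', ''m''}" "warrs push = {''mem'', ''known'', ''L''}"
  "wvars transfer = {''q'', ''p'', ''j''}" "warrs transfer = {''cnt''}"
  "wvars start = {''off'', ''base'', ''m''}" "warrs start = {''L'', ''known'', ''cnt''}"
  "wvars collect = {''i'', ''A'', ''j''}" "warrs collect = {''out''}"
  by (auto simp: push_def transfer_def start_def collect_def)

lemma wvars_fragments3 [simp]:
  "wvars step = {''A'', ''b'', ''u'', ''m'', ''q'', ''p'', ''j'', ''new'', ''l'', ''i'', ''off''}"
  "warrs step = {''mem'', ''known'', ''L'', ''cnt''}"
  by (auto simp: step_def)

lemma wvars_fragments4 [simp]:
  "wvars sweep = {''A'', ''b'', ''u'', ''m'', ''q'', ''p'', ''j'', ''new'', ''l'', ''i'', ''off'', ''f'', ''w''}"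
  "warrs sweep = {''mem'', ''known'', ''L'', ''cnt''}"
  by (auto simp: sweep_def)

section \<open>Representation invariants and correctness of the counting table\<close>

abbreviation big :: "nat \<Rightarrow> nat" where
  "big n \<equiv> (n + 2) * 2 ^ n"

text \<open>\<open>known\<close> is controlled only from \<open>base\<close> on; below lie the marks
  of earlier removals. The zeros above the current block are what the next removal will start
  from.\<close>

definition listed :: "nat \<Rightarrow> nat set list \<Rightarrow> state \<Rightarrow> bool" where
  "listed n Xs s \<longleftrightarrow> vars s ''m'' = length Xs \<and> (\<forall>i<length Xs. arrays s ''L'' i = code n (Xs ! i)) \<and>
     distinct Xs \<and> (\<forall>X\<in>set Xs. X \<subseteq> {..<n} \<and> mem_full n (arrays s ''mem'') X) \<and>
     mem_sound n (arrays s ''mem'') \<and>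
     (\<forall>X. X \<subseteq> {..<n} \<longrightarrow> arrays s ''known'' (vars s ''base'' + code n X) = (if X \<in> set Xs then 1 else 0)) \<and>
     (\<forall>z\<ge>vars s ''base'' + big n. arrays s ''known'' z = 0)"

lemma bcost_nbh_in_A: "bcost nbh_in_A \<le> 30"
  by (simp add: nbh_in_A_def)

lemma bcost_alive_nbh: "bcost alive_nbh \<le> 30"
  by (simp add: alive_nbh_def)

lemma run_push:
  assumes env: "env n cl s" and lst: "listed n Xs s" and i: "vars s ''i'' < length Xs" and w: "vars s ''w'' < n"
    and XA: "XA = Xs ! vars s ''i''" and XB: "XB = XA \<inter> Collect (cl (vars s ''w''))"
  shows "run push s ((n + 1) * 150) (\<lambda>s'. \<exists>Ys. listed n (Xs @ Ys) s' \<and> set Ys \<subseteq> {XB} \<and> XB \<in> set (Xs @ Ys) \<and>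
    vars s' ''A'' = code n XA \<and> vars s' ''b'' = code n XB)"
proof -
  have XAn: "XA \<subseteq> {..<n}" and full: "mem_full n (arrays s ''mem'') XA" and sound: "mem_sound n (arrays s ''mem'')"
    and A: "arrays s ''L'' (vars s ''i'') = code n XA"
    using lst i XA by (auto simp: listed_def)
  have XBn: "XB \<subseteq> {..<n}" using XAn XB by auto
  have cond: "bval nbh_in_A s' \<longleftrightarrow> vars s' ''u'' \<in> XB"
    if "env n cl s'" "vars s' ''A'' = code n XA" "vars s' ''w'' = vars s ''w''" "vars s' ''u'' < n"
      "mem_sound n (arrays s' ''mem'')" "mem_full n (arrays s' ''mem'') XA" for s'
    unfolding nbh_in_A_def using bval_Adj[OF that(1), of "''w''" "''u''"] mem_iff[OF that(5,6) XAn that(4)] that w XB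
    by simp
  let ?s0 = "s\<lparr>vars := (vars s)(''A'' := aval (Read ''L'' (Var ''i'')) s)\<rparr>"
  have env0: "env n cl ?s0" by (rule env_cong[OF env]) simp_all
  have 1: "run (encode ''b'' nbh_in_A) ?s0 ((n + 1) * 60) (\<lambda>s'. vars s' ''b'' = code n XB)"
  proof (rule run_encode[OF env0 _ _ XBn _ bcost_nbh_in_A])
    fix s' assume *: "same {''b'', ''u''} {} ?s0 s'" "vars s' ''u'' < n"
    have "env n cl s'" by (rule env_cong[OF env0]) (use *(1) in \<open>simp_all add: same_def\<close>)
    then show "bval nbh_in_A s' \<longleftrightarrow> vars s' ''u'' \<in> XB"
      by (rule cond) (use * sound full A in \<open>simp_all add: same_def\<close>)
  qed simp_all
  show ?thesis
    unfolding push_def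
  proof (rule run_Assign_Seq, rule run_call[OF 1], goal_cases)
    case 2: (1 s1)
    have s1: "same {''b'', ''u''} {} ?s0 s1" using 2 by simp
    have env1: "env n cl s1" by (rule env_cong[OF env]) (use s1 in \<open>auto simp: same_def\<close>)
    have A1: "vars s1 ''A'' = code n XA" "vars s1 ''w'' = vars s ''w''" "arrays s1 = arrays s"
      using s1 A by (auto simp: same_def)
    have 3: "run (mark ''b'' nbh_in_A) s1 ((n + 1) * 60) (\<lambda>s'. mem_sound n (arrays s' ''mem'') \<and>
      (\<forall>Y. mem_full n (arrays s1 ''mem'') Y \<longrightarrow> mem_full n (arrays s' ''mem'') Y) \<and> mem_full n (arrays s' ''mem'') XB)"
    proof (rule run_mark[OF _ _ _ XBn _ _ bcost_nbh_in_A])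
      fix s' assume *: "same {''u''} {''mem''} s1 s'" "vars s' ''u'' < n" "mem_sound n (arrays s' ''mem'')"
        "\<And>Y. mem_full n (arrays s1 ''mem'') Y \<Longrightarrow> mem_full n (arrays s' ''mem'') Y"
      have f: "mem_full n (arrays s' ''mem'') XA" using *(4) full A1(3) by simp
      have "env n cl s'" by (rule env_cong[OF env1]) (use *(1) in \<open>simp_all add: same_def\<close>)
      then show "bval nbh_in_A s' \<longleftrightarrow> vars s' ''u'' \<in> XB"
        by (rule cond) (use *(1,2,3) f A1 in \<open>simp_all add: same_def\<close>)
    qed (use 2 env1 sound A1(3) in \<open>simp_all add: env_def\<close>)
    show ?case
    proof (rule run_call[OF 3], goal_cases)
      case mk: (1 s2)
      have s2: "same {''u''} {''mem''} s1 s2" using mk(1) by simp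
      have vs: "vars s2 ''A'' = code n XA" "vars s2 ''b'' = code n XB" "vars s2 ''m'' = length Xs"
        "vars s2 ''base'' = vars s ''base''" "arrays s2 ''known'' = arrays s ''known''" "arrays s2 ''L'' = arrays s ''L''"
        using s2 A1 2(2) s1 lst by (auto simp: same_def listed_def)
      have full2: "\<forall>X\<in>set Xs. X \<subseteq> {..<n} \<and> mem_full n (arrays s2 ''mem'') X"
        using lst mk(2) A1(3) by (auto simp: listed_def)
      have kn: "arrays s ''known'' (vars s ''base'' + code n X) = (if X \<in> set Xs then 1 else 0)" if "X \<subseteq> {..<n}" for X
        using lst that by (simp add: listed_def)
      have kz: "\<forall>z\<ge>vars s ''base'' + big n. arrays s ''known'' z = 0" using lst by (simp add: listed_def)
      have L: "\<forall>i<length Xs. arrays s ''L'' i = code n (Xs ! i)" and dist: "distinct Xs"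
        using lst by (auto simp: listed_def)
      show ?case
      proof (rule run_If, goal_cases)
        case 1
        then have new: "XB \<notin> set Xs" using vs kn[OF XBn] by (simp split: if_splits)
        let ?s3 = "s2\<lparr>arrays := (arrays s2)(''known'' := (arrays s ''known'')(vars s ''base'' + code n XB := 1),
            ''L'' := (arrays s ''L'')(length Xs := code n XB)),
          vars := (vars s2)(''m'' := Suc (length Xs))\<rparr>"
        have ceq: "code n X = code n XB \<longleftrightarrow> X = XB" if "X \<subseteq> {..<n}" for X
          using code_eq_iff[OF that XBn, of 0 0] by simp
        have cl: "code n XB < big n" using code_less[OF XBn, of 0] by simp
        have "listed n (Xs @ [XB]) ?s3"
          unfolding listed_def
        proof (intro conjI, goal_cases)
          case 2
          then show ?case using L by (auto simp: nth_append less_Suc_eq)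
        next
          case 6
          then show ?case using kn ceq vs by auto
        next
          case 7
          then show ?case using kz cl vs by auto
        qed (use vs dist new full2 XBn mk(2) in auto)
        then show ?case
          by (intro run_Write_Seq run_Assign exI[of _ "[XB]"]) (simp_all add: vs)
      next
        case 2
        then have old: "XB \<in> set Xs" using vs kn[OF XBn] by (simp split: if_splits)
        have "listed n Xs s2" unfolding listed_def using vs dist full2 kn kz L mk(2) by simp
        then show ?case using old vs by (intro run_Skip exI[of _ "[]"]) simp_all
      qed
    qed
  qed
qed


text \<open>\<open>d\<close> is the degree shift of the row of \<open>Y\<close>. Even the shifted
  row ends at offset \<open>n + 1\<close> and so does not reach the cells of another set.\<close>

lemma code_in_row_iff:
  assumes "X \<subseteq> {..<n}" "Y \<subseteq> {..<n}" "j \<le> n" "d \<le> 1"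
  shows "code n Y + d \<le> code n X + j \<and> code n X + j < code n Y + d + n + 1 \<longleftrightarrow> X = Y \<and> d \<le> j"
proof
  assume *: "code n Y + d \<le> code n X + j \<and> code n X + j < code n Y + d + n + 1"
  define i where "i = code n X + j - code n Y"
  have i: "code n X + j = code n Y + i" "i < n + 2" "d \<le> i" using * assms(4) by (auto simp: i_def)
  then show "X = Y \<and> d \<le> j" using code_eq_iff[OF assms(1,2), of j i] assms(3) by simp
qed (use assms in auto)

lemma run_transfer:
  assumes n: "vars s ''n'' = n" and XA: "XA \<subseteq> {..<n}" and XB: "XB \<subseteq> {..<n}"
    and A: "vars s ''A'' = code n XA" and B: "vars s ''b'' = code n XB"
    and new: "vars s ''new'' = vars s ''off'' + big n"
    and mem: "mem_sound n (arrays s ''mem'')" "mem_full n (arrays s ''mem'') XA"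
    and w: "vars s ''w'' < n"
  shows "run transfer s ((n + 2) * 150) (\<lambda>s'.
    (\<forall>z. z < vars s ''new'' \<or> vars s ''new'' + big n \<le> z \<longrightarrow> arrays s' ''cnt'' z = arrays s ''cnt'' z) \<and>
    (\<forall>X j. X \<subseteq> {..<n} \<longrightarrow> j \<le> n \<longrightarrow> arrays s' ''cnt'' (vars s ''new'' + code n X + j) =
      arrays s ''cnt'' (vars s ''new'' + code n X + j) +
      (if XA = X \<and> vars s ''w'' \<notin> XA then arrays s ''cnt'' (vars s ''off'' + code n XA + j) else 0) +
      (if XB = X \<and> j \<noteq> 0 then arrays s ''cnt'' (vars s ''off'' + code n XA + (j - 1)) else 0)))"
proof -
  define off where "off = vars s ''off''"
  define q where "q = off + code n XA"
  define N where "N = off + big n"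
  define w where "w = vars s ''w''"
  define upd where "upd p f = (\<lambda>z::nat. if p \<le> z \<and> z < p + n + 1 then f z + f (q + (z - p)) else f z)"
    for p and f :: "nat \<Rightarrow> nat"
  define f0 where "f0 = arrays s ''cnt''"
  define f1 where "f1 = (if w \<in> XA then f0 else upd (N + code n XA) f0)"
  define f2 where "f2 = upd (N + code n XB + 1) f1"
  have lA: "code n XA + n < big n" "code n XB + n + 1 < big n" "n < big n"
    using code_less[OF XA, of n] code_less[OF XB, of "n + 1"] by simp_all
  have qN: "q + n < N" using lA by (simp add: q_def N_def)
  have newN: "vars s ''new'' = N" using new by (simp add: N_def off_def)
  have memw: "arrays s ''mem'' (code n XA + w) = 1 \<longleftrightarrow> w \<in> XA"
    using mem_iff[OF mem XA] assms(9) by (simp add: w_def)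
  let ?s0 = "s\<lparr>vars := (vars s)(''q'' := aval (Add (Var ''off'') (Var ''A'')) s)\<rparr>"
  have 1: "run (If (Equal (Read ''mem'' (Add (Var ''A'') (Var ''w''))) (Const 1)) Skip
           (Seq (Assign ''p'' (Add (Var ''new'') (Var ''A''))) add_row)) ?s0 ((n + 2) * 60 + 20)
      (\<lambda>s'. arrays s' ''cnt'' = f1)"
  proof (rule run_If, goal_cases)
    case 1
    then show ?case using memw A by (intro run_Skip) (auto simp: f1_def f0_def w_def)
  next
    case 2
    let ?s1 = "?s0\<lparr>vars := (vars ?s0)(''p'' := aval (Add (Var ''new'') (Var ''A'')) ?s0)\<rparr>"
    have "run add_row ?s1 ((n + 2) * 60) (\<lambda>s'. arrays s' ''cnt'' = upd (N + code n XA) f0)"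
    proof (rule run_conseq[OF run_add_row[where n = n]], goal_cases)
      case 2
      then show ?case using lA by (simp add: A new)
    next
      case (4 s')
      then show ?case using A newN unfolding upd_def q_def off_def f0_def by (simp cong: if_cong)
    qed (use n in simp_all)
    moreover have "w \<notin> XA" using 2 memw A by (simp add: w_def)
    ultimately show ?case by (intro run_Assign_Seq, elim run_conseq) (auto simp: f1_def)
  qed
  have "run transfer s ((n + 2) * 150) (\<lambda>s'. arrays s' ''cnt'' = f2)"
    unfolding transfer_def
  proof (rule run_Assign_Seq, rule run_call[OF 1], rule run_Assign_Seq, goal_cases)
    case 2: (1 s1)
    let ?s1 = "s1\<lparr>vars := (vars s1)(''p'' := aval (Add (Add (Var ''new'') (Var ''b'')) (Const 1)) s1)\<rparr>"
    have v1: "vars s1 ''new'' = N" "vars s1 ''b'' = code n XB" "vars s1 ''q'' = q" "vars s1 ''n'' = n"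
      using 2(1) A B newN n by (simp_all add: same_def q_def off_def)
    show ?case
    proof (rule run_conseq[OF run_add_row[where n = n]], goal_cases)
      case 2
      then show ?case using qN v1 by simp
    next
      case (4 s')
      then show ?case using 2(2) v1 unfolding upd_def f2_def by (simp cong: if_cong)
    qed (use v1 in simp_all)
  qed
  then show ?thesis
  proof (rule run_conseq, goal_cases)
    case 1
    show ?case by simp
  next
    case (2 s')
    then have c: "arrays s' ''cnt'' = f2" by simp
    have out: "f2 z = f0 z" if "z < N \<or> N + big n \<le> z" for z
      using that lA by (auto simp: f2_def f1_def upd_def)
    have in2: "f2 (N + code n X + j) = f0 (N + code n X + j) +
      (if XA = X \<and> w \<notin> XA then f0 (off + code n XA + j) else 0) +
      (if XB = X \<and> j \<noteq> 0 then f0 (off + code n XA + (j - 1)) else 0)" if X: "X \<subseteq> {..<n}" and j: "j \<le> n" for X j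
    proof -
      have r0: "N + code n XA \<le> N + code n X + j \<and> N + code n X + j < N + code n XA + n + 1 \<longleftrightarrow> X = XA"
        using code_in_row_iff[OF X XA j, of 0] by simp
      have r1: "N + code n XB + 1 \<le> N + code n X + j \<and> N + code n X + j < N + code n XB + 1 + n + 1 \<longleftrightarrow> X = XB \<and> j \<noteq> 0"
        using code_in_row_iff[OF X XB j, of 1] by (auto simp: add.assoc)
      \<comment> \<open>The second addition reads from the old block, which the first addition left
        alone.\<close>
      have low: "f1 z = f0 z" if "z < N" for z using that by (simp add: f1_def upd_def)
      have f1: "f1 (N + code n X + j) = f0 (N + code n X + j) + (if XA = X \<and> w \<notin> XA then f0 (off + code n XA + j) else 0)"
        using r0 by (auto simp: f1_def upd_def q_def)
      have "f2 (N + code n X + j) = f1 (N + code n X + j) +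
          (if XB = X \<and> j \<noteq> 0 then f1 (q + (j - 1)) else 0)"
        using r1 by (auto simp: f2_def upd_def)
      moreover have "f1 (q + (j - 1)) = f0 (off + code n XA + (j - 1))"
        using low qN j by (simp add: q_def)
      ultimately show ?thesis using f1 by (simp only:)
    qed
    show ?case
      unfolding c newN using out in2 unfolding f0_def off_def w_def by simp
  qed
qed


text \<open>
  Memory is never cleared: each update of the table of counts writes into a fresh block of \<open>big n\<close>
  cells starting at \<open>off\<close>, and membership in the list of anchor sets is recorded relative to \<open>base\<close>.
\<close>

definition dp :: "nat \<Rightarrow> (nat \<Rightarrow> nat \<Rightarrow> bool) \<Rightarrow> nat set \<Rightarrow> nat set set \<Rightarrow> nat set \<Rightarrow> nat set list \<Rightarrow> state \<Rightarrow> bool" where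
  "dp n cl C Fam W Xs s \<longleftrightarrow> env n cl s \<and> listed n Xs s \<and> set Xs \<subseteq> Fam \<and>
     (\<forall>U\<subseteq>W. anchor cl C (U - C) \<in> set Xs) \<and> vars s ''base'' \<le> vars s ''off'' \<and>
     (\<forall>X j. X \<subseteq> {..<n} \<longrightarrow> j \<le> n \<longrightarrow>
       arrays s ''cnt'' (vars s ''off'' + code n X + j) = size_count (blocked cl C W X) j) \<and>
     (\<forall>z\<ge>vars s ''off'' + big n. arrays s ''cnt'' z = 0)"

lemma listed_cong:
  assumes "listed n Xs s" "vars s' ''m'' = vars s ''m''" "vars s' ''base'' = vars s ''base''"
    "arrays s' ''L'' = arrays s ''L''" "arrays s' ''mem'' = arrays s ''mem''" "arrays s' ''known'' = arrays s ''known''"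
  shows "listed n Xs s'"
  using assms by (simp add: listed_def)

text \<open>An execution of \<open>size_count_blocked_insert\<close> with the listed sets as
  \<open>T\<close>. Closure of \<open>Fam\<close> under intersection with the closed neighbourhood
  of \<open>w\<close> keeps the extended list inside \<open>Fam\<close>; its size \<open>K\<close>
  bounds the number of rounds.\<close>

lemma run_step:
  assumes dp: "dp n cl C Fam W Xs s" and w: "vars s ''w'' = w" "w < n" "w \<notin> W" and W: "finite W"
    and C: "\<And>a b. a \<in> C \<Longrightarrow> b \<in> C \<Longrightarrow> cl a b" and WC: "w \<notin> C \<Longrightarrow> W \<inter> C = {}"
    and Fam: "finite Fam" "card Fam \<le> K" "\<And>A. A \<in> Fam \<Longrightarrow> A \<inter> Collect (cl w) \<in> Fam"
  shows "run step s ((K + 1) * ((n + 2) * 320)) (\<lambda>s'. \<exists>Xs'. dp n cl C Fam (insert w W) Xs' s')"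
proof -
  define off where "off = vars s ''off''"
  define t where "t A X j = (if A = X \<and> w \<notin> A then size_count (blocked cl C W A) j else 0) +
    (if A \<inter> Collect (cl w) = X \<and> j \<noteq> 0 then size_count (blocked cl C W A) (j - 1) else 0)" for A X j
  have env: "env n cl s" and lst: "listed n Xs s" and XsF: "set Xs \<subseteq> Fam"
    and cover: "\<forall>U\<subseteq>W. anchor cl C (U - C) \<in> set Xs" and base: "vars s ''base'' \<le> off"
    and cnt: "\<And>X j. X \<subseteq> {..<n} \<Longrightarrow> j \<le> n \<Longrightarrow> arrays s ''cnt'' (off + code n X + j) = size_count (blocked cl C W X) j"
    and zero: "\<And>z. off + big n \<le> z \<Longrightarrow> arrays s ''cnt'' z = 0"
    using dp by (auto simp: dp_def off_def)
  have dist: "distinct Xs" and Xsn: "\<And>X. X \<in> set Xs \<Longrightarrow> X \<subseteq> {..<n}" and m: "vars s ''m'' = length Xs"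
    using lst by (auto simp: listed_def)
  have lenK: "length Xs \<le> K"
    using distinct_card[OF dist] card_mono[OF Fam(1) XsF] Fam(2) by linarith
  have bigwt: "arrays s ''wt'' n = big n" and nn: "vars s ''n'' = n" using env by (simp_all add: env_def)
  let ?s0 = "s\<lparr>vars := (vars s)(''new'' := off + big n, ''l'' := length Xs)\<rparr>"
  \<comment> \<open>Old and new counts live in disjoint blocks, so sets processed later still see
    the old counts, while the fresh block collects the partial sums.\<close>
  let ?inv = "\<lambda>i s'. vars s' ''new'' = off + big n \<and> vars s' ''off'' = off \<and> vars s' ''w'' = w \<and>
    vars s' ''base'' = vars s ''base'' \<and> env n cl s' \<and>
    (\<exists>Ys. listed n (Xs @ Ys) s' \<and> set Ys \<subseteq> Fam \<and> (\<forall>A\<in>set (take i Xs). A \<inter> Collect (cl w) \<in> set (Xs @ Ys))) \<and>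
    (\<forall>z<off + big n. arrays s' ''cnt'' z = arrays s ''cnt'' z) \<and>
    (\<forall>z\<ge>off + big n + big n. arrays s' ''cnt'' z = 0) \<and>
    (\<forall>X j. X \<subseteq> {..<n} \<longrightarrow> j \<le> n \<longrightarrow>
      arrays s' ''cnt'' (off + big n + code n X + j) = (\<Sum>A\<in>set (take i Xs). t A X j))"
  have loop: "run (For ''i'' (Var ''l'') (Seq push transfer)) ?s0 ((length Xs + 1) * ((n + 2) * 300 + 1 + 7)) (?inv (length Xs))"
  proof (rule run_conseq[OF run_For[where N = "length Xs" and I = ?inv and T = "(n + 2) * 300"]], goal_cases)
    case (1 s')
    then show ?case by (simp add: same_def)
  next
    case 2
    show ?case by simp
  next
    case 3
    have "env n cl (?s0\<lparr>vars := (vars ?s0)(''i'' := 0)\<rparr>)" by (rule env_cong[OF env]) simp_all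
    moreover have "listed n (Xs @ []) (?s0\<lparr>vars := (vars ?s0)(''i'' := 0)\<rparr>)"
      unfolding append_Nil2 by (rule listed_cong[OF lst]) simp_all
    ultimately show ?case using w(1) zero
      by (intro conjI exI[of _ "[]"]) (simp_all add: off_def)
  next
    case (4 i s')
    then obtain Ys where l': "listed n (Xs @ Ys) s'" and Ys: "set Ys \<subseteq> Fam"
      and B: "\<forall>A\<in>set (take i Xs). A \<inter> Collect (cl w) \<in> set (Xs @ Ys)" by auto
    have v': "vars s' ''new'' = off + big n" "vars s' ''off'' = off" "vars s' ''w'' = w"
      "vars s' ''base'' = vars s ''base''" and env': "env n cl s'"
      and c': "\<And>z. z < off + big n \<Longrightarrow> arrays s' ''cnt'' z = arrays s ''cnt'' z"
      "\<And>z. off + big n + big n \<le> z \<Longrightarrow> arrays s' ''cnt'' z = 0"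
      "\<And>X j. X \<subseteq> {..<n} \<Longrightarrow> j \<le> n \<Longrightarrow>
        arrays s' ''cnt'' (off + big n + code n X + j) = (\<Sum>A\<in>set (take i Xs). t A X j)"
      using 4(2) by auto
    define XA where "XA = (Xs @ Ys) ! i"
    define XB where "XB = XA \<inter> Collect (cl w)"
    have XA: "XA = Xs ! i" "XA \<in> set Xs" using 4(1) by (simp_all add: XA_def nth_append)
    have XAn: "XA \<subseteq> {..<n}" and XBn: "XB \<subseteq> {..<n}" using XA Xsn by (auto simp: XB_def)
    have XBF: "XB \<in> Fam" using XA XsF Fam(3) by (auto simp: XB_def)
    have p: "run push s' ((n + 1) * 150) (\<lambda>s'. \<exists>Zs. listed n ((Xs @ Ys) @ Zs) s' \<and> set Zs \<subseteq> {XB} \<and>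
      XB \<in> set ((Xs @ Ys) @ Zs) \<and> vars s' ''A'' = code n XA \<and> vars s' ''b'' = code n XB)"
      by (rule run_push[OF env' l']) (use 4(1,3) v' w XA_def XB_def in simp_all)
    show ?case
    proof (rule run_call[OF p], goal_cases)
      case 5: (1 s1)
      then obtain Zs where l1: "listed n (Xs @ Ys @ Zs) s1" and Zs: "set Zs \<subseteq> {XB}" "XB \<in> set (Xs @ Ys @ Zs)"
        and AB: "vars s1 ''A'' = code n XA" "vars s1 ''b'' = code n XB" by auto
      have v1: "vars s1 ''new'' = off + big n" "vars s1 ''off'' = off" "vars s1 ''w'' = w"
        "vars s1 ''base'' = vars s ''base''" "arrays s1 ''cnt'' = arrays s' ''cnt''"
        using 5(1) v' by (simp_all add: same_def)
      have env1: "env n cl s1" by (rule env_cong[OF env']) (use 5(1) in \<open>simp_all add: same_def\<close>)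
      have mem1: "mem_sound n (arrays s1 ''mem'')" "mem_full n (arrays s1 ''mem'') XA"
        using l1 XA(2) by (auto simp: listed_def)
      have n1: "vars s1 ''n'' = n" using env1 by (simp add: env_def)
      have w1: "vars s1 ''w'' < n" using v1 w by simp
      have new1: "vars s1 ''new'' = vars s1 ''off'' + big n" using v1 by simp
      show ?case
      proof (rule run_conseq[OF run_transfer[OF n1 XAn XBn AB new1 mem1 w1]], goal_cases)
        case 1
        show ?case by simp
      next
        case 6: (2 s2)
        let ?s3 = "s2\<lparr>vars := (vars s2)(''i'' := Suc i)\<rparr>"
        have v2: "vars s2 ''new'' = off + big n" "vars s2 ''off'' = off" "vars s2 ''w'' = w"
          "vars s2 ''base'' = vars s ''base''"
          using 6(1) v1 by (simp_all add: same_def)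
        have env3: "env n cl ?s3" by (rule env_cong[OF env1]) (use 6(1) in \<open>simp_all add: same_def\<close>)
        have l3: "listed n (Xs @ Ys @ Zs) ?s3"
          by (rule listed_cong[OF l1]) (use 6(1) in \<open>simp_all add: same_def\<close>)
        have tk: "set (take (Suc i) Xs) = insert XA (set (take i Xs))" "XA \<notin> set (take i Xs)"
        proof -
          have "take (Suc i) Xs = take i Xs @ [XA]" using 4(1) XA(1) by (simp add: take_Suc_conv_app_nth)
          moreover have "distinct (take (Suc i) Xs)" using dist by simp
          ultimately show "set (take (Suc i) Xs) = insert XA (set (take i Xs))" "XA \<notin> set (take i Xs)" by auto
        qed
        have c2: "arrays s2 ''cnt'' z = arrays s' ''cnt'' z" if "z < off + big n \<or> off + big n + big n \<le> z" for z
          using 6(2) that v1 by metis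
        have c3: "arrays s2 ''cnt'' (off + big n + code n X + j) = (\<Sum>A\<in>set (take (Suc i) Xs). t A X j)"
          if X: "X \<subseteq> {..<n}" and j: "j \<le> n" for X j
        proof -
          have o: "arrays s' ''cnt'' (off + code n XA + j') = size_count (blocked cl C W XA) j'" if "j' \<le> n" for j'
            using c'(1) cnt[OF XAn that] code_less[OF XAn, of j'] that by simp
          have "arrays s2 ''cnt'' (off + big n + code n X + j) = arrays s' ''cnt'' (off + big n + code n X + j) +
            (if XA = X \<and> w \<notin> XA then arrays s' ''cnt'' (off + code n XA + j) else 0) +
            (if XB = X \<and> j \<noteq> 0 then arrays s' ''cnt'' (off + code n XA + (j - 1)) else 0)"
            using 6(2) X j unfolding v1 by blast
          also have "\<dots> = arrays s' ''cnt'' (off + big n + code n X + j) + t XA X j"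
            unfolding t_def XB_def using o[OF j] o[of "j - 1"] j by (simp only: add.assoc)
          also have "\<dots> = (\<Sum>A\<in>set (take (Suc i) Xs). t A X j)"
            unfolding c'(3)[OF X j] tk(1) using tk(2) by simp
          finally show ?thesis .
        qed
        have B3: "\<forall>A\<in>set (take (Suc i) Xs). A \<inter> Collect (cl w) \<in> set (Xs @ Ys @ Zs)"
          unfolding tk(1) using B Zs(2) by (auto simp: XB_def)
        show ?case
          by (intro conjI exI[of _ "Ys @ Zs"])
            (use v2 env3 l3 B3 c2 c3 c'(1,2) Ys Zs(1) XBF in auto)
      qed
    qed
  next
    case 5
    show ?case by simp
  next
    case (6 s')
    then show ?case by blast
  qed
  have time: "(length Xs + 1) * ((n + 2) * 300 + 1 + 7) + 20 \<le> (K + 1) * ((n + 2) * 320)"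
  proof -
    have "(length Xs + 1) * ((n + 2) * 300 + 1 + 7) \<le> (K + 1) * ((n + 2) * 300 + 1 + 7)"
      using lenK by (intro mult_le_mono1) simp
    then show ?thesis by (simp add: algebra_simps)
  qed
  show ?thesis
    unfolding step_def
  proof (rule run_Assign_Seq, rule run_Assign_Seq, goal_cases)
    case 1
    have s0: "s\<lparr>vars := (vars s)(''new'' := aval (Add (Var ''off'') (Read ''wt'' (Var ''n''))) s),
        vars := (vars (s\<lparr>vars := (vars s)(''new'' := aval (Add (Var ''off'') (Read ''wt'' (Var ''n''))) s)\<rparr>))
          (''l'' := aval (Var ''m'') (s\<lparr>vars := (vars s)(''new'' := aval (Add (Var ''off'') (Read ''wt'' (Var ''n''))) s)\<rparr>))\<rparr> = ?s0"
      by (simp add: nn bigwt m off_def)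
    show ?case
      unfolding s0
    proof (rule run_call[OF loop], rule run_Assign, goal_cases)
      case (1 s')
      let ?s1 = "s'\<lparr>vars := (vars s')(''off'' := aval (Var ''new'') s')\<rparr>"
      obtain Ys where l': "listed n (Xs @ Ys) s'" and Ys: "set Ys \<subseteq> Fam"
        and B: "\<forall>A\<in>set Xs. A \<inter> Collect (cl w) \<in> set (Xs @ Ys)" using 1(2) by auto
      have v': "vars s' ''new'' = off + big n" "vars s' ''base'' = vars s ''base''" and env': "env n cl s'"
        and c': "\<And>z. off + big n + big n \<le> z \<Longrightarrow> arrays s' ''cnt'' z = 0"
        "\<And>X j. X \<subseteq> {..<n} \<Longrightarrow> j \<le> n \<Longrightarrow>
          arrays s' ''cnt'' (off + big n + code n X + j) = (\<Sum>A\<in>set Xs. t A X j)"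
        using 1(2) by auto
      have "dp n cl C Fam (insert w W) (Xs @ Ys) ?s1"
        unfolding dp_def
      proof (intro conjI, goal_cases)
        case 1
        show ?case by (rule env_cong[OF env']) simp_all
      next
        case 2
        show ?case by (rule listed_cong[OF l']) simp_all
      next
        case 3
        show ?case using XsF Ys by simp
      next
        case 4
        show ?case
        proof (intro allI impI)
          fix U assume U: "U \<subseteq> insert w W"
          then have "U - {w} \<subseteq> W" by auto
          then have a: "anchor cl C (U - {w} - C) \<in> set Xs" using cover by blast
          show "anchor cl C (U - C) \<in> set (Xs @ Ys)"
          \<comment> \<open>Only a new vertex outside \<open>C\<close> changes the anchor set; the
            loop has then listed the smaller one.\<close>
          proof (cases "w \<in> U \<and> w \<notin> C")
            case True
            then have "U - C = insert w (U - {w} - C)" by auto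
            then have "anchor cl C (U - C) = anchor cl C (U - {w} - C) \<inter> Collect (cl w)"
              by (auto simp: anchor_def)
            then show ?thesis using a B by simp
          next
            case False
            then have "U - C = U - {w} - C" by auto
            then show ?thesis using a by simp
          qed
        qed
      next
        case 5
        show ?case using v' base by simp
      next
        case 6
        have "size_count (blocked cl C (insert w W) X) j = (\<Sum>A\<in>set Xs. t A X j)" for X j
          unfolding t_def
          by (rule size_count_blocked_insert[OF W]) (use cover w C WC in auto)
        then show ?case using c'(2) v' by simp
      next
        case 7
        show ?case using c'(1) v' by simp
      qed
      then show ?case by blast
    next
      case (2 s')
      show ?case using time by simp
    qed
  qed
qed

lemma dp_cong:
  assumes "dp n cl C Fam W Xs s" "\<forall>x\<in>{''n'', ''m'', ''base'', ''off''}. vars s' x = vars s x" "arrays s' = arrays s"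
  shows "dp n cl C Fam W Xs s'"
  using assms unfolding dp_def listed_def env_def by simp

lemma run_start:
  assumes env: "env n cl s" and C: "C \<subseteq> {..<n}" and c: "vars s ''c'' = code n C"
    and mem: "mem_sound n (arrays s ''mem'')" "mem_full n (arrays s ''mem'') C"
    and zero: "\<forall>z\<ge>vars s ''off'' + big n. arrays s ''cnt'' z = 0 \<and> arrays s ''known'' z = 0"
    and Fam: "C \<in> Fam"
  shows "run start s 40 (\<lambda>s'. dp n cl C Fam {} [C] s')"
proof -
  define N where "N = vars s ''off'' + big n"
  have wt: "arrays s ''wt'' n = big n" and nn: "vars s ''n'' = n" using env by (simp_all add: env_def)
  have zero': "arrays s ''cnt'' (N + z) = 0" "arrays s ''known'' (N + z) = 0" for z
    using zero by (simp_all add: N_def)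
  have zero'': "arrays s ''cnt'' z = 0" "arrays s ''known'' z = 0" if "N \<le> z" for z
    using zero that by (simp_all add: N_def)
  have ceq: "code n X + j = code n C \<longleftrightarrow> X = C \<and> j = 0" if "X \<subseteq> {..<n}" "j \<le> n" for X j
    using code_eq_iff[OF that(1) C, of j 0] that by simp
  have clt: "code n C < big n" using code_less[OF C, of 0] by simp
  have sc: "size_count (blocked cl C {} X) j = (if X = C \<and> j = 0 then 1 else 0)" for X j
  proof -
    have "blocked cl C {} X = (if X = C then {{}} else {})" by (auto simp: blocked_def anchor_def)
    then show ?thesis by (simp add: size_count_def cong: conj_cong)
  qed
  let ?s = "s\<lparr>vars := (vars s)(''off'' := N, ''base'' := N, ''m'' := 1),
    arrays := (arrays s)(''L'' := (arrays s ''L'')(0 := code n C),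
      ''known'' := (arrays s ''known'')(N + code n C := 1), ''cnt'' := (arrays s ''cnt'')(N + code n C := 1))\<rparr>"
  have "dp n cl C Fam {} [C] ?s"
    unfolding dp_def
  proof (intro conjI, goal_cases)
    case 1
    show ?case by (rule env_cong[OF env]) simp_all
  next
    case 2
    show ?case unfolding listed_def using C mem clt zero'' ceq[of _ 0]
      by (auto simp: zero')
  next
    case 4
    show ?case by (auto simp: anchor_def)
  next
    case 6
    show ?case using ceq by (auto simp: sc zero' add.assoc)
  next
    case 7
    show ?case using clt zero'' by auto
  qed (use Fam in auto)
  then show ?thesis
    unfolding start_def
    by (intro run_Assign_Seq run_Write_Seq run_Write) (simp_all add: nn wt c N_def)
qed

lemma run_sweep:
  assumes dp: "dp n cl C Fam {} Xs s" and al: "alive n R s" and v: "vars s ''v'' = v" "v < n"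
    and R: "R \<subseteq> {..<n}" and C: "C = {u \<in> R. cl v u}"
    and clq: "\<And>a b. a \<in> C \<Longrightarrow> b \<in> C \<Longrightarrow> cl a b"
    and Fam: "finite Fam" "card Fam \<le> K" "\<And>A w. A \<in> Fam \<Longrightarrow> w \<in> R \<Longrightarrow> A \<inter> Collect (cl w) \<in> Fam"
  shows "run sweep s ((n + 1) * ((K + 1) * ((n + 2) * 2000))) (\<lambda>s'. \<exists>Xs. dp n cl C Fam R Xs s')"
proof -
  \<comment> \<open>The vertices decided once round \<open>f\<close> has reached index
    \<open>i\<close>: those not adjacent to \<open>v\<close> in round 0, those of \<open>C\<close>
    in round 1.\<close>
  define W where "W f i = {u \<in> R. if cl v u then f = 1 \<and> u < i \<or> 2 \<le> f else f = 0 \<and> u < i \<or> 1 \<le> f}" for f i :: nat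
  have W0: "W 0 0 = {}" and W2: "W 2 0 = R" by (auto simp: W_def)
  have Wn: "W f n = W (Suc f) 0" if "f < 2" for f using that R by (auto simp: W_def)
  have finW: "finite (W f i)" for f i using R by (auto simp: W_def intro: finite_subset[of _ "{..<n}"])
  have envn: "vars s ''n'' = n" using dp by (simp add: dp_def env_def)
  let ?S = "(K + 1) * ((n + 2) * 320) + 30"
  show ?thesis
    unfolding sweep_def
  proof (rule run_conseq[OF run_For[where N = 2 and T = "(n + 1) * (?S + 8)" and
        I = "\<lambda>f s'. \<exists>Xs. dp n cl C Fam (W f 0) Xs s'"]], goal_cases)
    case 1
    show ?case by simp
  next
    case 2
    show ?case by simp
  next
    case 3
    have "dp n cl C Fam {} Xs (s\<lparr>vars := (vars s)(''f'' := 0)\<rparr>)" by (rule dp_cong[OF dp]) simp_all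
    then show ?case unfolding W0 by blast
  next
    case (4 f s1)
    show ?case
    proof (rule run_conseq[OF run_For[where N = n and T = ?S and
        I = "\<lambda>i s'. \<exists>Xs. dp n cl C Fam (W f i) Xs s'"]], goal_cases)
      case (1 s')
      then show ?case using envn 4(4) by (simp add: same_def)
    next
      case 2
      show ?case by simp
    next
      case 3
      from 4(2) obtain Xs where "dp n cl C Fam (W f 0) Xs s1" by blast
      then have "dp n cl C Fam (W f 0) Xs (s1\<lparr>vars := (vars s1)(''w'' := 0)\<rparr>)" by (rule dp_cong) simp_all
      then show ?case by blast
    next
      case w: (4 w s2)
      then obtain Xs where dp2: "dp n cl C Fam (W f w) Xs s2" by blast
      have env2: "env n cl s2" using dp2 by (simp add: dp_def)
      have v2: "vars s2 ''v'' = v" "vars s2 ''f'' = f" "arrays s2 ''alive'' = arrays s ''alive''"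
        using w(4) 4(3,4) v by (simp_all add: same_def)
      have row: "arrays s2 ''row'' v = v * n" and adj: "arrays s2 ''adj'' (v * n + w) = (if cl v w then 1 else 0)"
        using env2 v w(1) by (simp_all add: env_def)
      have al2: "arrays s2 ''alive'' w = 1 \<longleftrightarrow> w \<in> R" using al v2 w(1) by (simp add: alive_def)
      have f01: "f = 0 \<or> f = 1" using 4(1) by auto
      show ?case
      proof (rule run_If, goal_cases)
        case 1
        then have wR: "w \<in> R" and fw: "f = (if cl v w then 1 else 0)"
          using al2 adj row v2 w(3) by auto
        have Wi: "W f (Suc w) = insert w (W f w)" "w \<notin> W f w" using wR fw by (auto simp: W_def less_Suc_eq)
        \<comment> \<open>A vertex outside \<open>C\<close> is treated in round 0, when nothing in
          \<open>C\<close> has been decided.\<close>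
        have WC: "W f w \<inter> C = {}" if "w \<notin> C" using that fw wR unfolding C by (auto simp: W_def split: if_splits)
        have "run step s2 ((K + 1) * ((n + 2) * 320)) (\<lambda>s'. \<exists>Xs'. dp n cl C Fam (insert w (W f w)) Xs' s')"
          by (rule run_step[OF dp2 w(3,1) Wi(2) finW]) (use clq WC Fam wR in blast)+
        then show ?case
        proof (rule run_conseq, goal_cases)
          case 1
          show ?case by simp
        next
          case (2 s3)
          then obtain Xs' where "dp n cl C Fam (insert w (W f w)) Xs' s3" by blast
          then have "dp n cl C Fam (insert w (W f w)) Xs' (s3\<lparr>vars := (vars s3)(''w'' := Suc w)\<rparr>)"
            by (rule dp_cong) simp_all
          then show ?case unfolding Wi by blast
        qed
      next
        case 2
        then have "\<not> (w \<in> R \<and> f = (if cl v w then 1 else 0))" using al2 adj row v2 w(3) by auto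
        then have "W f (Suc w) = W f w" using f01 by (auto simp: W_def less_Suc_eq split: if_splits)
        moreover have "dp n cl C Fam (W f w) Xs (s2\<lparr>vars := (vars s2)(''w'' := Suc w)\<rparr>)"
          by (rule dp_cong[OF dp2]) simp_all
        ultimately show ?case by (intro run_Skip) auto
      qed
    next
      case 5
      show ?case by simp
    next
      case (6 s2)
      then obtain Xs where "dp n cl C Fam (W f n) Xs s2" by blast
      then have "dp n cl C Fam (W f n) Xs (s2\<lparr>vars := (vars s2)(''f'' := Suc f)\<rparr>)" by (rule dp_cong) simp_all
      then show ?case unfolding Wn[OF 4(1)] by blast
    qed
  next
    case 5
    define P where "P = (K + 1) * (n + 2)"
    define Q where "Q = (n + 1) * P"
    have P1: "1 \<le> P" by (simp add: P_def)
    then have Q1: "1 \<le> Q" by (simp add: Q_def)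
    have "?S + 8 \<le> 400 * P" using P1 by (simp add: P_def algebra_simps)
    then have "(n + 1) * (?S + 8) \<le> (n + 1) * (400 * P)" by (rule mult_le_mono2)
    also have "\<dots> = 400 * Q" by (simp add: Q_def)
    finally have "(2 + 1) * ((n + 1) * (?S + 8) + acost (Const 2) + 7) \<le> 2000 * Q" using Q1 by simp
    also have "2000 * Q = (n + 1) * ((K + 1) * ((n + 2) * 2000))" by (simp add: Q_def P_def algebra_simps)
    finally show ?case .
  next
    case (6 s')
    then show ?case unfolding W2 by blast
  qed
qed

lemma run_collect:
  assumes dp: "dp n cl C Fam R Xs s" and C: "C \<subseteq> {..<n}" "Suc (card C) \<le> n"
    and v: "vars s ''c'' = code n C" "vars s ''z'' = card C" and Fam: "finite Fam" "card Fam \<le> K"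
  shows "run collect s ((K + 1) * ((n + 1) * 100)) (\<lambda>s'. \<forall>j\<le>n. arrays s' ''out'' j =
    arrays s ''out'' j + (if j = card C \<and> size_count (blocked cl C R C) (Suc (card C)) = 0 then 1 else 0) -
    (if j = 0 then 0 else \<Sum>A\<in>set Xs. size_count (blocked cl C R A) (j - 1)))"
proof -
  have env: "env n cl s" and lst: "listed n Xs s" and XsF: "set Xs \<subseteq> Fam"
    and cnt: "\<And>X j. X \<subseteq> {..<n} \<Longrightarrow> j \<le> n \<Longrightarrow> arrays s ''cnt'' (vars s ''off'' + code n X + j) = size_count (blocked cl C R X) j"
    using dp by (auto simp: dp_def)
  have dist: "distinct Xs" and Xsn: "\<And>X. X \<in> set Xs \<Longrightarrow> X \<subseteq> {..<n}" and m: "vars s ''m'' = length Xs"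
    and L: "\<And>i. i < length Xs \<Longrightarrow> arrays s ''L'' i = code n (Xs ! i)"
    using lst by (auto simp: listed_def)
  have lenK: "length Xs \<le> K"
    using distinct_card[OF dist] card_mono[OF Fam(1) XsF] Fam(2) by linarith
  have nn: "vars s ''n'' = n" using env by (simp add: env_def)
  define g where "g j = arrays s ''out'' j + (if j = card C \<and> size_count (blocked cl C R C) (Suc (card C)) = 0 then 1 else 0)" for j
  define h where "h i j = (if j = 0 then 0 else \<Sum>A\<in>set (take i Xs). size_count (blocked cl C R A) (j - 1))" for i j :: nat
  have 1: "run (If (Equal (Read ''cnt'' (Add (Add (Var ''off'') (Var ''c'')) (Add (Var ''z'') (Const 1)))) (Const 0))
      (Write ''out'' (Var ''z'') (Add (Read ''out'' (Var ''z'')) (Const 1))) Skip) s 30 (\<lambda>s'. \<forall>j\<le>n. arrays s' ''out'' j = g j)"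
  proof -
    have "arrays s ''cnt'' (vars s ''off'' + code n C + Suc (card C)) = size_count (blocked cl C R C) (Suc (card C))"
      by (rule cnt[OF C])
    then show ?thesis using v by (intro run_If run_Write run_Skip) (auto simp: g_def)
  qed
  have 2: "run (For ''i'' (Var ''m'') (Seq (Assign ''A'' (Read ''L'' (Var ''i'')))
      (For ''j'' (Var ''n'')
        (Write ''out'' (Add (Var ''j'') (Const 1))
          (Sub (Read ''out'' (Add (Var ''j'') (Const 1)))
               (Read ''cnt'' (Add (Add (Var ''off'') (Var ''A'')) (Var ''j''))))))))
      s1 ((length Xs + 1) * ((n + 1) * 25 + 5 + 8)) (\<lambda>s'. \<forall>j\<le>n. arrays s' ''out'' j = g j - h (length Xs) j)"
    if s1: "same {} {''out''} s s1" "\<forall>j\<le>n. arrays s1 ''out'' j = g j" for s1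
  proof (rule run_conseq[OF run_For[where N = "length Xs" and T = "(n + 1) * 25 + 5" and
        I = "\<lambda>i s'. \<forall>j\<le>n. arrays s' ''out'' j = g j - h i j"]], goal_cases)
    case (1 s')
    then show ?case using s1 m by (simp add: same_def)
  next
    case 2
    show ?case by simp
  next
    case 3
    then show ?case using s1 by (simp add: h_def)
  next
    case i: (4 i s2)
    define A where "A = Xs ! i"
    have An: "A \<subseteq> {..<n}" using Xsn i(1) by (simp add: A_def)
    have LA: "arrays s2 ''L'' i = code n A" using i(1,4) s1(1) L by (simp add: A_def same_def)
    have v2: "vars s2 ''n'' = n" "vars s2 ''off'' = vars s ''off''" "arrays s2 ''cnt'' = arrays s ''cnt''"
      using i(4) s1(1) nn by (simp_all add: same_def)
    have tk: "set (take (Suc i) Xs) = insert A (set (take i Xs))" "A \<notin> set (take i Xs)"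
    proof -
      have "take (Suc i) Xs = take i Xs @ [A]" using i(1) by (simp add: take_Suc_conv_app_nth A_def)
      moreover have "distinct (take (Suc i) Xs)" using dist by simp
      ultimately show "set (take (Suc i) Xs) = insert A (set (take i Xs))" "A \<notin> set (take i Xs)" by auto
    qed
    have hS: "h (Suc i) j = h i j + (if j = 0 then 0 else size_count (blocked cl C R A) (j - 1))" for j
      using tk(2) by (simp add: h_def tk(1))
    show ?case
    proof (rule run_Assign_Seq, rule run_conseq[OF run_For[where N = n and T = 15 and
        \<comment> \<open>Adding \<open>v\<close> to a set of size \<open>k\<close> gives size
          \<open>k + 1\<close>, so after \<open>k\<close> rounds the degrees up to \<open>k\<close>
          are corrected; degree 0 is never touched, as \<open>h\<close> vanishes there.\<close>
        I = "\<lambda>k s'. \<forall>j\<le>n. arrays s' ''out'' j = g j - (if j \<le> k then h (Suc i) j else h i j)"]], goal_cases)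
      case (1 s')
      then show ?case using v2 by (simp add: same_def)
    next
      case 2
      show ?case by simp
    next
      case 3
      then show ?case using i(2) by (auto simp: hS)
    next
      case k: (4 k s3)
      have v3: "vars s3 ''off'' = vars s ''off''" "vars s3 ''A'' = code n A" "arrays s3 ''cnt'' = arrays s ''cnt''"
        using k(4) v2 LA i(3) by (simp_all add: same_def)
      have "arrays s ''cnt'' (vars s ''off'' + code n A + k) = size_count (blocked cl C R A) k"
        using cnt[OF An] k(1) by simp
      moreover have "arrays s3 ''out'' (Suc k) = g (Suc k) - h i (Suc k)" using k(1,2) by simp
      ultimately show ?case using k(2)
        by (intro run_Write) (auto simp: v3 k(3) hS le_Suc_eq)
    next
      case 5
      show ?case by (simp add: algebra_simps)
    next
      case (6 s')
      then show ?case by simp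
    qed
  next
    case 5
    show ?case by simp
  next
    case (6 s')
    then show ?case by blast
  qed
  have time: "(length Xs + 1) * ((n + 1) * 25 + 5 + 8) + 30 \<le> (K + 1) * ((n + 1) * 100)"
  proof -
    have "(length Xs + 1) * ((n + 1) * 25 + 5 + 8) \<le> (K + 1) * ((n + 1) * 25 + 5 + 8)"
      using lenK by (intro mult_le_mono1) simp
    then show ?thesis by (simp add: algebra_simps)
  qed
  show ?thesis
    unfolding collect_def
  proof (rule run_call[OF 1], goal_cases)
    case (1 s1)
    then have "same {} {''out''} s s1" by simp
    then show ?case
    proof (rule run_conseq[OF 2], goal_cases)
      case 1
      then show ?case using \<open>\<forall>j\<le>n. arrays s1 ''out'' j = g j\<close> .
    next
      case 2
      show ?case using time by simp
    next
      case (3 s')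
      then show ?case by (simp add: g_def h_def)
    qed
  qed
qed

section \<open>Elimination of simplicial vertices\<close>

text \<open>
  The array \<open>out\<close> starts with the number of all nonempty vertex sets of each size, from which the bad
  sets are subtracted. The summand for \<open>j = 0\<close> accounts for the empty set.
\<close>

definition elim_inv :: "nat \<Rightarrow> (nat \<Rightarrow> nat \<Rightarrow> bool) \<Rightarrow> nat set \<Rightarrow> state \<Rightarrow> bool" where
  "elim_inv n cl R s \<longleftrightarrow> R \<subseteq> {..<n} \<and> env n cl s \<and> alive n R s \<and> deficits n cl R s \<and>
     mem_sound n (arrays s ''mem'') \<and>
     (\<forall>z\<ge>vars s ''off'' + big n. arrays s ''cnt'' z = 0 \<and> arrays s ''known'' z = 0) \<and>
     (\<forall>j\<le>n. arrays s ''out'' j + size_count (common_nbr_sets cl R) j + (if j = 0 then 1 else 0) =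
       size_count (common_nbr_sets cl {..<n}) j + size_count (Pow R) j)"

lemma size_count_mono: "S \<subseteq> T \<Longrightarrow> finite T \<Longrightarrow> size_count S j \<le> size_count T j"
  unfolding size_count_def by (rule card_mono) auto

lemma run_eliminate:
  assumes inv: "elim_inv n cl R s"
    and sym: "\<And>a b. cl a b \<Longrightarrow> cl b a"
    and ex: "\<exists>y\<in>R. \<forall>a\<in>R. \<forall>b\<in>R. cl y a \<longrightarrow> cl y b \<longrightarrow> cl a b"
    and K: "\<And>v C. v \<in> R \<Longrightarrow> C = {u \<in> R - {v}. cl v u} \<Longrightarrow> (\<And>a b. a \<in> C \<Longrightarrow> b \<in> C \<Longrightarrow> cl a b) \<Longrightarrow>
      card (anchor cl C ` Pow (R - {v} - C)) \<le> K"
  shows "run eliminate s ((n + 1) * ((K + 1) * ((n + 2) * 3000))) (\<lambda>s'. \<exists>v\<in>R. elim_inv n cl (R - {v}) s')"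
proof -
  have R: "R \<subseteq> {..<n}" and env: "env n cl s" and al: "alive n R s" and def: "deficits n cl R s"
    and snd: "mem_sound n (arrays s ''mem'')"
    and zero: "\<forall>z\<ge>vars s ''off'' + big n. arrays s ''cnt'' z = 0 \<and> arrays s ''known'' z = 0"
    and out: "\<And>j. j \<le> n \<Longrightarrow> arrays s ''out'' j + size_count (common_nbr_sets cl R) j + (if j = 0 then 1 else 0) =
       size_count (common_nbr_sets cl {..<n}) j + size_count (Pow R) j"
    using inv by (auto simp: elim_inv_def)
  have finR: "finite R" using R finite_subset by blast
  have time: "(n + 1) * ((n + 1) * 80) + 4 + (n + 1) * 60 + (n + 1) * 60 + (n + 1) * 60 + 40 + (n + 1) * ((K + 1) * ((n + 2) * 2000)) +
      (K + 1) * ((n + 1) * 100) + (n + 1) * ((n + 1) * 100) \<le> (n + 1) * ((K + 1) * ((n + 2) * 3000))"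
    by (simp add: algebra_simps)
  show ?thesis
    unfolding eliminate_def
  proof (rule run_call[OF run_find_simplicial[OF env al def R ex]], rule run_Write_Seq, goal_cases)
    case (1 s1)
    define v where "v = vars s1 ''v''"
    define R' where "R' = R - {v}"
    define C where "C = {u \<in> R'. cl v u}"
    define s2 where "s2 = s1\<lparr>arrays := (arrays s1)(''alive'' := (arrays s1 ''alive'')(aval (Var ''v'') s1 := aval (Const 0) s1))\<rparr>"
    \<comment> \<open>All anchor sets that the remaining graph can produce. The family is closed
      under further intersections: a vertex of \<open>C\<close> changes nothing, and any other
      vertex of \<open>R'\<close> can be added to \<open>M\<close>.\<close>
    define Fam where "Fam = anchor cl C ` Pow (R' - C)"
    have vR: "v \<in> R" and simpl: "\<And>a b. a \<in> R \<Longrightarrow> b \<in> R \<Longrightarrow> cl v a \<Longrightarrow> cl v b \<Longrightarrow> cl a b"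
      using 1(2) by (auto simp: v_def)
    have vn: "v < n" using vR R by auto
    have clq: "\<And>a b. a \<in> C \<Longrightarrow> b \<in> C \<Longrightarrow> cl a b" using simpl by (auto simp: C_def R'_def)
    have R'n: "R' \<subseteq> {..<n}" and vR': "v \<notin> R'" and RR': "R = insert v R'" and finR': "finite R'"
      using R vR finR by (auto simp: R'_def)
    have Cn: "C \<subseteq> {..<n}" and CR': "C \<subseteq> R'" using R'n by (auto simp: C_def)
    \<comment> \<open>\<open>v\<close> is a vertex outside \<open>C\<close>. The cell of degree
      \<open>card C + 1\<close> read by \<open>collect\<close> is thus one that \<open>dp\<close>
      describes.\<close>
    have cardC: "Suc (card C) \<le> n"
    proof -
      have "card (insert v C) \<le> card {..<n}" using Cn vn by (intro card_mono) auto
      moreover have "finite C" "v \<notin> C" using CR' finR' finite_subset vR' by blast+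
      ultimately show ?thesis by simp
    qed
    have Fam: "finite Fam" "card Fam \<le> K" "C \<in> Fam" "\<And>A w. A \<in> Fam \<Longrightarrow> w \<in> R' \<Longrightarrow> A \<inter> Collect (cl w) \<in> Fam"
    proof -
      show "finite Fam" using finR' by (simp add: Fam_def)
      have "C = {u \<in> R - {v}. cl v u}" by (simp add: C_def R'_def)
      from K[OF vR this clq] show "card Fam \<le> K" unfolding Fam_def R'_def by blast
      have "C = anchor cl C {}" by (simp add: anchor_def)
      then show "C \<in> Fam" unfolding Fam_def by blast
      fix A w assume "A \<in> Fam" and w: "w \<in> R'"
      then obtain M where M: "M \<subseteq> R' - C" "A = anchor cl C M" by (auto simp: Fam_def)
      show "A \<inter> Collect (cl w) \<in> Fam"
      proof (cases "w \<in> C")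
        case True
        then have "A \<inter> Collect (cl w) = A" using M(2) clq by (auto simp: anchor_def)
        then show ?thesis using \<open>A \<in> Fam\<close> by simp
      next
        case False
        have "A \<inter> Collect (cl w) = anchor cl C (insert w M)" using M(2) by (auto simp: anchor_def)
        then show ?thesis unfolding Fam_def using M(1) w False by blast
      qed
    qed
    have s2: "same {''x'', ''a'', ''ok'', ''v''} {''alive''} s s2"
      using 1(1) by (auto simp: same_def s2_def)
    have v2: "vars s2 ''v'' = v" by (simp add: s2_def v_def)
    have env2: "env n cl s2" by (rule env_cong[OF env]) (use s2 in \<open>simp_all add: same_def\<close>)
    have al2: "alive n R' s2"
      using al 1(1) vn by (auto simp: alive_def s2_def same_def R'_def v_def)
    have cond: "bval alive_nbh s' \<longleftrightarrow> vars s' ''u'' \<in> C"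
      if "vars s' ''n'' = vars s2 ''n''" "vars s' ''v'' = vars s2 ''v''" "arrays s' ''row'' = arrays s2 ''row''"
        "arrays s' ''adj'' = arrays s2 ''adj''" "arrays s' ''wt'' = arrays s2 ''wt''"
        "arrays s' ''alive'' = arrays s2 ''alive''" "vars s' ''u'' < n" for s'
    proof -
      have "env n cl s'" by (rule env_cong[OF env2]) (use that in simp_all)
      from bval_Adj[OF this, of "''v''" "''u''"] show ?thesis
        unfolding alive_nbh_def C_def using al2 that vn v2 by (simp add: alive_def)
    qed
    have enc: "run (encode ''c'' alive_nbh) s2 ((n + 1) * 60) (\<lambda>s'. vars s' ''c'' = code n C)"
    proof (rule run_encode[OF env2 _ _ Cn _ bcost_alive_nbh])
      fix s' assume "same {''c'', ''u''} {} s2 s'" "vars s' ''u'' < n"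
      then show "bval alive_nbh s' \<longleftrightarrow> vars s' ''u'' \<in> C" by (intro cond) (simp_all add: same_def)
    qed simp_all
    have "run (Seq (encode ''c'' alive_nbh) (Seq (mark ''c'' alive_nbh) (Seq (count_marked ''z'' alive_nbh)
      (Seq start (Seq sweep (Seq collect (update_D Sub ''v'')))))))
      s2 ((n + 1) * ((K + 1) * ((n + 2) * 3000)) - (n + 1) * ((n + 1) * 80) - 3) (\<lambda>s'. \<exists>v\<in>R. elim_inv n cl (R - {v}) s')"
    proof (rule run_call[OF enc], goal_cases)
      case s3: (1 s3)
      have f3: "same {''c'', ''u''} {} s2 s3" using s3(1) by simp
      have env3: "env n cl s3" by (rule env_cong[OF env2]) (use f3 in \<open>simp_all add: same_def\<close>)
      have n3: "vars s3 ''n'' = n" using env3 by (simp add: env_def)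
      have snd3: "mem_sound n (arrays s3 ''mem'')" using snd f3 s2 by (simp add: same_def)
      have mrk: "run (mark ''c'' alive_nbh) s3 ((n + 1) * 60) (\<lambda>s'. mem_sound n (arrays s' ''mem'') \<and>
        (\<forall>Y. mem_full n (arrays s3 ''mem'') Y \<longrightarrow> mem_full n (arrays s' ''mem'') Y) \<and> mem_full n (arrays s' ''mem'') C)"
      proof (rule run_mark[OF n3 _ s3(2) Cn snd3 _ bcost_alive_nbh])
        fix s' assume "same {''u''} {''mem''} s3 s'" "vars s' ''u'' < n"
        then show "bval alive_nbh s' \<longleftrightarrow> vars s' ''u'' \<in> C" by (intro cond) (use f3 in \<open>simp_all add: same_def\<close>)
      qed simp
      show ?case
      proof (rule run_call[OF mrk], goal_cases)
        case s4: (1 s4)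
        have f4: "same {''c'', ''u''} {''mem''} s2 s4" using s4(1) f3 by (simp add: same_def)
        have c4: "vars s4 ''c'' = code n C" using s3(2) s4(1) by (simp add: same_def)
        have env4: "env n cl s4" by (rule env_cong[OF env2]) (use f4 in \<open>simp_all add: same_def\<close>)
        have cn: "run (count_marked ''z'' alive_nbh) s4 ((n + 1) * 60) (\<lambda>s'. vars s' ''z'' = card C)"
        proof (rule run_count_marked[OF env4 _ _ Cn _ bcost_alive_nbh])
          fix s' assume "same {''z'', ''u''} {} s4 s'" "vars s' ''u'' < n"
          then show "bval alive_nbh s' \<longleftrightarrow> vars s' ''u'' \<in> C" by (intro cond) (use f4 in \<open>simp_all add: same_def\<close>)
        qed simp_all
        show ?case
        proof (rule run_call[OF cn], goal_cases)
          case s5: (1 s5)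
          have f5: "same {''c'', ''u'', ''z''} {''mem''} s2 s5" using s5(1) f4 by (simp add: same_def)
          have c5: "vars s5 ''c'' = code n C" using c4 s5(1) by (simp add: same_def)
          have env5: "env n cl s5" by (rule env_cong[OF env2]) (use f5 in \<open>simp_all add: same_def\<close>)
          have mem5: "mem_sound n (arrays s5 ''mem'')" "mem_full n (arrays s5 ''mem'') C"
            using s4(2) s5(1) by (simp_all add: same_def)
          have zero5: "\<forall>z\<ge>vars s5 ''off'' + big n. arrays s5 ''cnt'' z = 0 \<and> arrays s5 ''known'' z = 0"
            using zero f5 s2 by (simp add: same_def)
          show ?case
          proof (rule run_call[OF run_start[OF env5 Cn c5 mem5 zero5 Fam(3)]], goal_cases)
            case s6: (1 s6)
            have f6: "same {''off'', ''base'', ''m''} {''L'', ''known'', ''cnt''} s5 s6" using s6(1) by simp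
            have al6: "alive n R' s6" using al2 f6 f5 by (simp add: alive_def same_def)
            have v6: "vars s6 ''v'' = v" using v2 f6 f5 by (simp add: same_def)
            have sw: "run sweep s6 ((n + 1) * ((K + 1) * ((n + 2) * 2000))) (\<lambda>s'. \<exists>Xs. dp n cl C Fam R' Xs s')"
              by (rule run_sweep[OF s6(2) al6 v6 vn R'n C_def]) (use clq Fam in blast)+
            show ?case
            proof (rule run_call[OF sw], goal_cases)
              case s7: (1 s7)
              then obtain Xs where dp7: "dp n cl C Fam R' Xs s7" by blast
              have f7: "vars s7 ''c'' = code n C" "vars s7 ''z'' = card C" "vars s7 ''v'' = v"
                "arrays s7 ''out'' = arrays s ''out''" "arrays s7 ''D'' = arrays s ''D''" "arrays s7 ''alive'' = arrays s2 ''alive''"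
                using s7(1) f6 c5 s5(2) v6 f5 s2 by (simp_all add: same_def)
              show ?case
              proof (rule run_call[OF run_collect[OF dp7 Cn cardC f7(1,2) Fam(1,2)]], goal_cases)
                case s8: (1 s8)
                have f8: "same {''i'', ''A'', ''j''} {''out''} s7 s8" using s8(1) by simp
                have env7: "env n cl s7" using dp7 by (simp add: dp_def)
                have env8: "env n cl s8" by (rule env_cong[OF env7]) (use f8 in \<open>simp_all add: same_def\<close>)
                have v8: "vars s8 ''v'' = v" using f8 f7 by (simp add: same_def)
                show ?case
                proof (rule run_conseq[OF run_update_D[OF env8, where g = "\<lambda>m. m - 1"]], goal_cases)
                  case 1
                  show ?case using v8 vn by simp
                next
                  case 6
                  show ?case using time by linarith
                next
                  case s9: (7 s9)
                  have f9: "same {''x'', ''a''} {''D''} s8 s9" using s9(1) by simp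
                  have "elim_inv n cl R' s9"
                    unfolding elim_inv_def
                  proof (intro conjI, goal_cases)
                    case 1
                    show ?case by (rule R'n)
                  next
                    case 2
                    show ?case by (rule env_cong[OF env8]) (use f9 in \<open>simp_all add: same_def\<close>)
                  next
                    case 3
                    show ?case using al2 f9 f8 f7 by (simp add: alive_def same_def)
                  next
                    case 4
                    have c: "card {b \<in> R. cl x b \<and> \<not> cl a b} = (if cl x v \<and> \<not> cl a v
                      then Suc (card {b \<in> R'. cl x b \<and> \<not> cl a b}) else card {b \<in> R'. cl x b \<and> \<not> cl a b})" for x a
                      unfolding RR' by (rule card_Collect_insert[OF finR' vR'])
                    have "arrays s8 ''D'' = arrays s ''D''" using f8 f7 by (simp add: same_def)
                    then show ?case using def s9(2) unfolding deficits_def c v8 by simp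
                  next
                    case 5
                    show ?case using dp7 f8 f9 by (simp add: dp_def listed_def same_def)
                  next
                    case 6
                    show ?case using dp7 f8 f9 by (simp add: dp_def listed_def same_def)
                  next
                    case 7
                    show ?case
                    proof (intro allI impI)
                      fix j assume j: "j \<le> n"
                      let ?new = "if j = card C \<and> size_count (blocked cl C R' C) (Suc (card C)) = 0 then 1 else (0::nat)"
                      let ?bad = "if j = 0 then 0 else \<Sum>A\<in>set Xs. size_count (blocked cl C R' A) (j - 1)"
                      have o9: "arrays s9 ''out'' j = arrays s ''out'' j + ?new - ?bad"
                        using s8(2) j f9 f7(4) by (simp add: same_def)
                      have st: "size_count (common_nbr_sets cl (insert v R')) j + ?bad + size_count (Pow R') j =
                        size_count (common_nbr_sets cl R') j + size_count (Pow (insert v R')) j + ?new"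
                        by (rule size_count_common_nbr_sets_insert[of R' v C cl, OF finR' vR' C_def])
                          (use clq sym dp7 in \<open>auto simp: dp_def\<close>)
                      \<comment> \<open>This makes the truncated subtraction exact: the new entry
                        has to be the final count plus the number of subsets of \<open>R'\<close> of
                        size \<open>j\<close> outside the complex of \<open>R'\<close>, up to the
                        correction at degree 0.\<close>
                      have le: "size_count (common_nbr_sets cl R') j \<le> size_count (Pow R') j"
                        by (rule size_count_mono) (use finR' in \<open>auto simp: common_nbr_sets_def\<close>)
                      show "arrays s9 ''out'' j + size_count (common_nbr_sets cl R') j + (if j = 0 then 1 else 0) =
                        size_count (common_nbr_sets cl {..<n}) j + size_count (Pow R') j"
                      proof (cases "j = 0")
                        case True
                        then show ?thesis using o9 st out[OF j] unfolding RR' by simp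
                      next
                        case False
                        then show ?thesis using o9 st le out[OF j] unfolding RR' by simp
                      qed
                    qed
                  qed
                  then show ?case using vR unfolding R'_def by blast
                qed simp_all
              qed
            qed
          qed
        qed
      qed
    qed
    then show ?case unfolding s2_def by simp
  qed
qed


section \<open>The complete program\<close>

lemma run_init_tables:
  assumes cl: "cl = (\<lambda>u w. u = w \<or> (u, w) \<in> parcs G)"
  shows "run init_tables (input_state n G) ((n + 1) * 100) (\<lambda>s'. env n cl s' \<and> alive n {..<n} s')"
proof -
  let ?s = "input_state n G"
  let ?inv = "\<lambda>i s'. (\<forall>j\<le>i. arrays s' ''row'' j = j * n) \<and> (\<forall>j\<le>i. arrays s' ''wt'' j = (n + 2) * 2 ^ j) \<and>
    (\<forall>p<n. \<forall>q<n. arrays s' ''adj'' (p * n + q) = (if (p, q) \<in> parcs G \<or> p = q \<and> p < i then 1 else 0)) \<and>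
    (\<forall>j<i. arrays s' ''alive'' j = 1)"
  have nn: "vars ?s ''n'' = n" by (simp add: input_state_def)
  show ?thesis
    unfolding init_tables_def
  proof (rule run_Write_Seq, rule run_conseq[OF run_For[where N = n and T = 60 and I = ?inv]], goal_cases)
    case (1 s')
    then show ?case using nn by (simp add: same_def)
  next
    case 2
    show ?case by simp
  next
    case 3
    have "p * n + q < n * n" if "p < n" "q < n" for p q
    proof -
      have "p * n + q < p * n + n" using that by simp
      also have "\<dots> = Suc p * n" by simp
      also have "\<dots> \<le> n * n" using that by (intro mult_le_mono1) simp
      finally show ?thesis .
    qed
    then show ?case by (simp add: input_state_def)
  next
    case (4 i s')
    have n': "vars s' ''n'' = n" using nn 4(4) by (simp add: same_def)
    have rw: "arrays s' ''row'' i = i * n" "arrays s' ''wt'' i = (n + 2) * 2 ^ i" using 4(2) by auto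
    show ?case
    proof (intro run_Write_Seq run_Write, goal_cases)
      case 1
      have a: "p * n + q = i * n + i \<longleftrightarrow> p = i \<and> q = i" if "q < n" for p q
        using index_inj[OF that 4(1)] .
      show ?case
      proof (intro conjI, goal_cases)
        case 1
        show ?case using 4(2) by (simp add: n' rw 4(3) le_Suc_eq)
      next
        case 2
        show ?case using 4(2) by (simp add: n' rw 4(3) le_Suc_eq)
      next
        case 3
        show ?case using 4(2) by (auto simp add: n' rw 4(3) a less_Suc_eq)
      next
        case 4
        show ?case using \<open>?inv i s'\<close> by (simp add: less_Suc_eq \<open>vars s' ''i'' = i\<close>)
      qed
    next
      case 2
      show ?case by simp
    qed
  next
    case 5
    show ?case by (simp add: algebra_simps)
  next
    case (6 s')
    then show ?case using nn by (auto simp: env_def alive_def cl same_def)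
  qed
qed

text \<open>The graph theory enters only through \<open>ex\<close>, which keeps the elimination
  going until no vertex is left, and through \<open>K\<close>. Both are required for all
  \<open>R\<close>, because the order of removal is chosen by the program.\<close>

lemma run_nbh_program:
  assumes cl: "cl = (\<lambda>u w. u = w \<or> (u, w) \<in> parcs G)" and sym: "\<And>a b. cl a b \<Longrightarrow> cl b a"
    and ex: "\<And>R. R \<subseteq> {..<n} \<Longrightarrow> R \<noteq> {} \<Longrightarrow> \<exists>y\<in>R. \<forall>a\<in>R. \<forall>b\<in>R. cl y a \<longrightarrow> cl y b \<longrightarrow> cl a b"
    and K: "\<And>R v C. R \<subseteq> {..<n} \<Longrightarrow> v \<in> R \<Longrightarrow> C = {u \<in> R - {v}. cl v u} \<Longrightarrow>
      (\<And>a b. a \<in> C \<Longrightarrow> b \<in> C \<Longrightarrow> cl a b) \<Longrightarrow> card (anchor cl C ` Pow (R - {v} - C)) \<le> K"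
  shows "run nbh_program (input_state n G) ((n + 1) * ((n + 1) * ((K + 1) * ((n + 2) * 4000))))
    (\<lambda>s'. \<forall>j\<le>n. arrays s' ''out'' j = size_count (common_nbr_sets cl {..<n}) j)"
proof -
  have time: "(n + 1) * 100 + (n + 1) * ((n + 1) * ((n + 1) * 110)) + (n + 1) * ((n + 1) * 50) +
      (n + 1) * ((n + 1) * ((K + 1) * ((n + 2) * 3000)) + 1 + 7) \<le> (n + 1) * ((n + 1) * ((K + 1) * ((n + 2) * 4000)))"
    by (simp add: algebra_simps)
  show ?thesis
    unfolding nbh_program_def
  proof (rule run_call[OF run_init_tables[OF cl]], goal_cases)
    case s1: (1 s1)
    have f1: "same {''i''} {''wt'', ''row'', ''adj'', ''alive''} (input_state n G) s1" using s1(1) by simp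
    have D: "\<And>z. arrays s1 ''D'' z = 0" using f1 by (simp add: same_def input_state_def)
    show ?case
    proof (rule run_call[OF run_init_D[OF conjunct1[OF s1(2)] D]], goal_cases)
      case s2: (1 s2)
      have f2: "same {''b'', ''x'', ''a''} {''D''} s1 s2" using s2(1) by simp
      have n2: "vars s2 ''n'' = n" using f2 s1(2) by (simp add: same_def env_def)
      have o2: "\<And>z. arrays s2 ''out'' z = 0" using f1 f2 by (simp add: same_def input_state_def)
      show ?case
      proof (rule run_call[OF run_pascal[OF n2 o2]], goal_cases)
        case s3: (1 s3)
        have f3: "same {''i'', ''j''} {''out''} s2 s3" using s3(1) by simp
        have env3: "env n cl s3" by (rule env_cong[OF conjunct1[OF s1(2)]]) (use f2 f3 in \<open>simp_all add: same_def\<close>)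
        have z3: "arrays s3 ''mem'' z = 0" "arrays s3 ''cnt'' z = 0" "arrays s3 ''known'' z = 0" for z
          using f1 f2 f3 by (simp_all add: same_def input_state_def)
        have pow: "size_count (Pow {..<n}) j = n choose j" for j
          using n_subsets[of "{..<n}" j] by (simp add: size_count_def Pow_def)
        have inv3: "elim_inv n cl {..<n} s3"
          unfolding elim_inv_def
        proof (intro conjI, goal_cases)
          case 3
          show ?case using s1(2) f2 f3 by (simp add: alive_def same_def)
        next
          case 4
          show ?case using s2(2) f3 by (simp add: deficits_def same_def)
        next
          case 7
          show ?case using s3(2) by (simp add: pow)
        qed (use env3 z3 in \<open>simp_all add: mem_sound_def\<close>)
        show ?case
        proof (rule run_conseq[OF run_For[where N = n and T = "(n + 1) * ((K + 1) * ((n + 2) * 3000))" and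
            I = "\<lambda>e s'. \<exists>R. card R = n - e \<and> elim_inv n cl R s'"]], goal_cases)
          case (1 s')
          then show ?case using env3 by (simp add: same_def env_def eliminate_def)
        next
          case 2
          show ?case by (simp add: eliminate_def)
        next
          case 3
          have "elim_inv n cl {..<n} (s3\<lparr>vars := (vars s3)(''e'' := 0)\<rparr>)"
            using inv3 by (simp add: elim_inv_def env_def alive_def deficits_def)
          then show ?case by (intro exI[of _ "{..<n}"]) simp
        next
          case (4 e s')
          then obtain R where R: "card R = n - e" and inv: "elim_inv n cl R s'" by blast
          have Rn: "R \<subseteq> {..<n}" using inv by (simp add: elim_inv_def)
          have "R \<noteq> {}" using R 4(1) by auto
          have "run eliminate s' ((n + 1) * ((K + 1) * ((n + 2) * 3000))) (\<lambda>s'. \<exists>v\<in>R. elim_inv n cl (R - {v}) s')"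
            by (rule run_eliminate[OF inv _ ex[OF Rn \<open>R \<noteq> {}\<close>] K[OF Rn]]) (use sym in blast)+
          then show ?case
          proof (rule run_conseq, goal_cases)
            case 1
            show ?case by simp
          next
            case (2 s'')
            then obtain v where v: "v \<in> R" "elim_inv n cl (R - {v}) s''" by blast
            have "elim_inv n cl (R - {v}) (s''\<lparr>vars := (vars s'')(''e'' := Suc e)\<rparr>)"
              using v(2) by (simp add: elim_inv_def env_def alive_def deficits_def)
            moreover have "card (R - {v}) = n - Suc e" using v(1) R by simp
            ultimately show ?case by blast
          qed
        next
          case 5
          show ?case using time by simp
        next
          case (6 s')
          then obtain R where "card R = 0" and inv: "elim_inv n cl R s'" by auto
          moreover have "finite R" using inv finite_subset by (auto simp: elim_inv_def)
          ultimately have "R = {}" by simp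
          \<comment> \<open>With no vertex left, the power set term of the invariant cancels its
            summand for degree 0, and \<open>out\<close> equals the count for the whole
            graph.\<close>
          moreover have "size_count (common_nbr_sets cl {}) j = 0" for j
            by (simp add: size_count_def common_nbr_sets_def)
          moreover have "size_count (Pow ({} :: nat set)) j = (if j = 0 then 1 else 0)" for j
            by (simp add: size_count_def cong: conj_cong)
          ultimately show ?case using inv by (simp add: elim_inv_def)
        qed
      qed
    qed
  qed
qed

section \<open>Return to the neighbourhood polynomial and the anchor width\<close>

lemma coeff_nbh_poly:
  assumes "finite (nbh_complex G)"
  shows "coeff (nbh_poly G) j = int (size_count (nbh_complex G) j)"
proof -
  have "coeff (nbh_poly G) j = (\<Sum>U\<in>nbh_complex G. if card U = j then 1 else 0)"
    by (simp add: nbh_poly_def coeff_sum)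
  also have "\<dots> = int (size_count (nbh_complex G) j)"
    using assms by (simp add: size_count_def sum.inter_filter[symmetric])
  finally show ?thesis .
qed

text \<open>\<open>LEAST\<close> is meaningful only once some bound exists; finiteness of the vertex
  set supplies \<open>2 ^ card (pverts G)\<close>.\<close>

lemma card_anchor_family_le:
  assumes "finite (pverts G)" "clique G C"
  shows "card (anchor_family G C) \<le> anchor_width G"
proof -
  have "\<forall>C. clique G C \<longrightarrow> card (anchor_family G C) \<le> 2 ^ card (pverts G)"
  proof (intro allI impI)
    fix C assume "clique G C"
    then have "anchor_family G C \<subseteq> Pow (pverts G)" by (auto simp: clique_def anchor_family_def)
    then show "card (anchor_family G C) \<le> 2 ^ card (pverts G)"
      using assms(1) by (metis card_Pow card_mono finite_Pow_iff)
  qed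
  then have "\<forall>C. clique G C \<longrightarrow> card (anchor_family G C) \<le> anchor_width G"
    unfolding anchor_width_def by (rule LeastI)
  then show ?thesis using assms(2) by blast
qed


theorem theorem1:
  "\<exists>(alg :: com) (c :: nat). \<forall>(n :: nat) (k :: nat) (G :: nat pair_pre_digraph).
     pair_graph G \<and> pverts G = {..<n} \<and> chordal G \<and> anchor_width G = k \<longrightarrow>
     (\<exists>t s. exec alg (input_state n G) t s \<and>
        output_poly n s = nbh_poly G \<and>
        (n \<ge> 1 \<longrightarrow> t \<le> c * (n ^ 3 * k + n ^ 2 * k ^ 2)))"
proof (rule exI[of _ nbh_program], rule exI[of _ "2 * 2 * 3 * 3 * 4000"], intro allI impI)
  fix n k :: nat and G :: "nat pair_pre_digraph"
  assume "pair_graph G \<and> pverts G = {..<n} \<and> chordal G \<and> anchor_width G = k"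
  then interpret pair_graph G by simp
  from \<open>pair_graph G \<and> _\<close> have V: "pverts G = {..<n}" and ch: "chordal G" and k: "anchor_width G = k"
    by simp_all
  define cl where "cl = (\<lambda>u w. u = w \<or> (u, w) \<in> parcs G)"
  have sym: "cl b a" if "cl a b" for a b using that parcs_sym[of a b] by (auto simp: cl_def)
  have edge: "(u, w) \<in> parcs G \<longleftrightarrow> cl u w \<and> u \<noteq> w" for u w using parcs_irrefl by (auto simp: cl_def)
  have ex: "\<exists>y\<in>R. \<forall>a\<in>R. \<forall>b\<in>R. cl y a \<longrightarrow> cl y b \<longrightarrow> cl a b" if R: "R \<subseteq> {..<n}" "R \<noteq> {}" for R
  proof -
    obtain y where y: "y \<in> R"
      "\<And>a b. a \<in> R \<Longrightarrow> b \<in> R \<Longrightarrow> (y, a) \<in> parcs G \<Longrightarrow> (y, b) \<in> parcs G \<Longrightarrow> a \<noteq> b \<Longrightarrow> (a, b) \<in> parcs G"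
      using chordal_simplicial[OF ch, of R] R V by metis
    have "cl a b" if "a \<in> R" "b \<in> R" "cl y a" "cl y b" for a b
      using y(2)[OF that(1,2)] that(3,4) sym[of y a] by (auto simp: cl_def)
    then show ?thesis using y(1) by blast
  qed
  have K: "card (anchor cl C ` Pow (R - {v} - C)) \<le> k + 1"
    if R: "R \<subseteq> {..<n}" and v: "v \<in> R" and C: "C = {u \<in> R - {v}. cl v u}"
      and clq: "\<And>a b. a \<in> C \<Longrightarrow> b \<in> C \<Longrightarrow> cl a b" for R v C
  proof -
    have CR: "C \<subseteq> R" using C by auto
    have cG: "clique G C" using CR R V clq edge by (auto simp: clique_def)
    have "anchor cl C M \<in> insert {} (anchor_family G C)" if M: "M \<subseteq> R - {v} - C" for M
    proof (cases "anchor cl C M = {}")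
      case False
      \<comment> \<open>A vertex of the anchor set is adjacent to all of \<open>M\<close> and
        thereby places \<open>M\<close> in the periphery. As \<open>M\<close> and \<open>C\<close>
        are disjoint, \<open>cl\<close> and adjacency agree between them.\<close>
      then obtain c where c: "c \<in> C" "\<And>m. m \<in> M \<Longrightarrow> cl m c" by (auto simp: anchor_def)
      have adj: "(x, m) \<in> parcs G \<longleftrightarrow> cl m x" if "x \<in> C" "m \<in> M" for x m
        using that M edge[of x m] sym by blast
      have "M \<subseteq> periphery G C"
      proof
        fix m assume m: "m \<in> M"
        have "m \<in> nbh G c" using adj[OF c(1) m] c(2)[OF m] parcs_sym[of c m] M m R V by (auto simp: nbh_def)
        then show "m \<in> periphery G C" using c(1) m M by (auto simp: periphery_def nbh_Union_def)
      qed
      moreover have "anchor cl C M = anchor_set G M C"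
        using adj CR R V by (auto simp: anchor_def anchor_set_def nbh_Inter_def nbh_def)
      ultimately have "anchor cl C M \<in> anchor_family G C"
        using False anchor_subset[of cl C M] by (auto simp: anchor_family_def)
      then show ?thesis by simp
    qed simp
    then have "anchor cl C ` Pow (R - {v} - C) \<subseteq> insert {} (anchor_family G C)" by blast
    moreover have fin: "finite (anchor_family G C)"
      using cG V by (auto simp: clique_def anchor_family_def intro!: finite_subset[of _ "Pow {..<n}"])
    ultimately have "card (anchor cl C ` Pow (R - {v} - C)) \<le> card (insert {} (anchor_family G C))"
      by (intro card_mono) auto
    also have "\<dots> \<le> Suc (card (anchor_family G C))" by (rule card_insert_le_m1) simp_all
    also have "\<dots> \<le> k + 1" using card_anchor_family_le[OF pair_finite_verts cG] k by simp
    finally show ?thesis .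
  qed
  have "run nbh_program (input_state n G) ((n + 1) * ((n + 1) * ((k + 1 + 1) * ((n + 2) * 4000))))
    (\<lambda>s'. \<forall>j\<le>n. arrays s' ''out'' j = size_count (common_nbr_sets cl {..<n}) j)"
    by (rule run_nbh_program[OF cl_def _ ex K]) (use sym in blast)+
  then obtain t s where ts: "exec nbh_program (input_state n G) t s"
    "t \<le> (n + 1) * ((n + 1) * ((k + 1 + 1) * ((n + 2) * 4000)))"
    and out: "\<And>j. j \<le> n \<Longrightarrow> arrays s ''out'' j = size_count (common_nbr_sets cl {..<n}) j"
    by (auto simp: run_def)
  have cx: "nbh_complex G = common_nbr_sets cl {..<n}"
    using V edge by (auto simp: nbh_complex_def common_nbr_sets_def nbh_def subset_iff)
  have fin: "finite (nbh_complex G)"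
    using V by (auto simp: nbh_complex_def intro: finite_subset[of _ "Pow {..<n}"])
  have "output_poly n s = nbh_poly G"
  proof (rule poly_eqI)
    fix j
    have "size_count (nbh_complex G) j = 0" if "n < j"
    proof -
      have "card U \<le> n" if "U \<in> nbh_complex G" for U
        using that V card_mono[of "{..<n}" U] by (auto simp: nbh_complex_def)
      then have "{U \<in> nbh_complex G. card U = j} = {}" using \<open>n < j\<close> by fastforce
      then show ?thesis unfolding size_count_def by (simp only: card.empty)
    qed
    then show "coeff (output_poly n s) j = coeff (nbh_poly G) j"
      unfolding coeff_nbh_poly[OF fin] output_poly_def coeff_Poly_eq
      using out[of j] cx by (auto simp: nth_default_def simp del: upt_Suc)
  qed
  moreover have "t \<le> 2 * 2 * 3 * 3 * 4000 * (n ^ 3 * k + n ^ 2 * k ^ 2)" if n: "n \<ge> 1"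
  proof -
    \<comment> \<open>The clique \<open>{0}\<close> with \<open>M = {}\<close> has the anchor set
      \<open>{0}\<close>, so \<open>k\<close> is positive; this is needed to absorb the additive
      constants into the bound.\<close>
    have "clique G {0}" using n V by (auto simp: clique_def)
    moreover have "anchor_set G {} {0} = {0}" using n V by (auto simp: anchor_set_def nbh_Inter_def)
    then have "{0} \<in> anchor_family G {0}" unfolding anchor_family_def by blast
    moreover have "finite (anchor_family G {0})"
      by (rule finite_subset[of _ "Pow {0}"]) (auto simp: anchor_family_def)
    ultimately have "0 < card (anchor_family G {0})" "card (anchor_family G {0}) \<le> k"
      using card_anchor_family_le[OF pair_finite_verts, of "{0}"] k by (auto simp: card_gt_0_iff)
    then have "k \<ge> 1" by simp
    \<comment> \<open>The factors of the constant: \<open>n + 1\<close> is at most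
      \<open>2 * n\<close>, twice, \<open>k + 2\<close> at most \<open>3 * k\<close>, and
      \<open>n + 2\<close> at most \<open>3 * n\<close>.\<close>
    then have "(n + 1) * ((n + 1) * ((k + 1 + 1) * ((n + 2) * 4000))) \<le>
        (2 * n) * ((2 * n) * ((3 * k) * ((3 * n) * 4000)))"
      using n by (intro mult_le_mono) simp_all
    also have "\<dots> = 2 * 2 * 3 * 3 * 4000 * (n ^ 3 * k)" by (simp add: power3_eq_cube algebra_simps)
    also have "\<dots> \<le> 2 * 2 * 3 * 3 * 4000 * (n ^ 3 * k + n ^ 2 * k ^ 2)" by simp
    finally show ?thesis using ts(2) by linarith
  qed
  ultimately show "\<exists>t s. exec nbh_program (input_state n G) t s \<and> output_poly n s = nbh_poly G \<and>
      (n \<ge> 1 \<longrightarrow> t \<le> 2 * 2 * 3 * 3 * 4000 * (n ^ 3 * k + n ^ 2 * k ^ 2))"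
    using ts(1) by blast
qed

end
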